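(* The following problem is decidable: given a rational relation $R\subseteq\Sigma^*\times\Gamma^*$, decide whether $R$ has a uniformization by a recognizable relation, i.e. whether there is a function $g:\mathrm{dom}(R)\to\Gamma^*$ with $(u,g(u))\in R$ for all $u\in\mathrm{dom}(R)$ whose graph $\{(u,g(u)):u\in\mathrm{dom}(R)\}$ is a recognizable relation.
   Context: $\Sigma,\Gamma$ are disjoint finite alphabets. For $w\in(\Sigma\cup\Gamma)^*$, $\llbracket w\rrbracket=(\pi_{\mathtt i}(w),\pi_{\mathtt o}(w))$ where $\pi_{\mathtt i}$ (resp. $\pi_{\mathtt o}$) deletes all letters of $\Gamma$ (resp. $\Sigma$). A relation is rational if it equals $\{\llbracket w\rrbracket:w\in S\}$ for some regular $S\subseteq(\Sigma\cup\Gamma)^*$ (it is given by such an $S$, e.g. via an NFA). A relation is recognizable if it is a finite union of products $U\times V$ with $U\subseteq\Sigma^*$, $V\subseteq\Gamma^*$ regular. *)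

theory Defs
  imports Main "HOL-Library.Nat_Bijection"
begin

datatype recf =
    Zero
  | Succ
  | Proj nat
  | Comp recf "recf list"
  | Prim recf recf
  | Mn recf

inductive eval :: "recf \<Rightarrow> nat list \<Rightarrow> nat \<Rightarrow> bool" where
  eval_Zero: "eval Zero xs 0"
| eval_Succ: "eval Succ (x # xs) (Suc x)"
| eval_Proj: "i < length xs \<Longrightarrow> eval (Proj i) xs (xs ! i)"
| eval_Comp: "length ys = length fs \<Longrightarrow> (\<forall>i < length fs. eval (fs ! i) xs (ys ! i))
     \<Longrightarrow> eval g ys r \<Longrightarrow> eval (Comp g fs) xs r"
| eval_Prim0: "eval f xs r \<Longrightarrow> eval (Prim f g) (0 # xs) r"
| eval_PrimS: "eval (Prim f g) (n # xs) r \<Longrightarrow> eval g (n # r # xs) r'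
     \<Longrightarrow> eval (Prim f g) (Suc n # xs) r'"
| eval_Mn: "eval f (n # xs) 0 \<Longrightarrow> (\<forall>j < n. \<exists>r. eval f (j # xs) r \<and> r > 0)
     \<Longrightarrow> eval (Mn f) xs n"

datatype 'c nfa = NFA (trans: "(nat \<times> 'c \<times> nat) list") (inits: "nat list") (finals: "nat list")

inductive path :: "(nat \<times> 'c \<times> nat) list \<Rightarrow> nat \<Rightarrow> 'c list \<Rightarrow> nat \<Rightarrow> bool" where
  path_Nil: "path T p [] p"
| path_Cons: "(p, c, q) \<in> set T \<Longrightarrow> path T q w r \<Longrightarrow> path T p (c # w) r"

definition lang :: "'c nfa \<Rightarrow> 'c list set" where
  "lang A = {w. \<exists>p \<in> set (inits A). \<exists>q \<in> set (finals A). path (trans A) p w q}"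

definition regular :: "'c set \<Rightarrow> 'c list set \<Rightarrow> bool" where
  "regular S L \<longleftrightarrow> L \<subseteq> lists S \<and> (\<exists>A. lang A = L)"

text \<open>The input alphabet Sigma is {..<m}, the output alphabet Gamma is {..<k};
  the disjoint union Sigma \<union> Gamma is realised as letters Inl a (a in Sigma) and Inr b (b in Gamma).\<close>

fun pi_in :: "(nat + nat) list \<Rightarrow> nat list" where
  "pi_in [] = []"
| "pi_in (Inl a # w) = a # pi_in w"
| "pi_in (Inr b # w) = pi_in w"

fun pi_out :: "(nat + nat) list \<Rightarrow> nat list" where
  "pi_out [] = []"
| "pi_out (Inl a # w) = pi_out w"
| "pi_out (Inr b # w) = b # pi_out w"

definition sem :: "(nat + nat) list \<Rightarrow> nat list \<times> nat list" where
  "sem w = (pi_in w, pi_out w)"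

definition mixed_alph :: "nat \<Rightarrow> nat \<Rightarrow> (nat + nat) set" where
  "mixed_alph m k = Inl ` {..<m} \<union> Inr ` {..<k}"

definition wf_input :: "nat \<Rightarrow> nat \<Rightarrow> (nat + nat) nfa \<Rightarrow> bool" where
  "wf_input m k A \<longleftrightarrow> (\<forall>(p, c, q) \<in> set (trans A). c \<in> mixed_alph m k)"

definition rat_rel :: "(nat + nat) nfa \<Rightarrow> (nat list \<times> nat list) set" where
  "rat_rel A = sem ` lang A"

definition recognizable :: "nat \<Rightarrow> nat \<Rightarrow> (nat list \<times> nat list) set \<Rightarrow> bool" where
  "recognizable m k R \<longleftrightarrow>
     (\<exists>F. finite F \<and> (\<forall>(U, V) \<in> F. regular {..<m} U \<and> regular {..<k} V)
        \<and> R = (\<Union>(U, V) \<in> F. U \<times> V))"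

definition has_recognizable_uniformization ::
  "nat \<Rightarrow> nat \<Rightarrow> (nat list \<times> nat list) set \<Rightarrow> bool" where
  "has_recognizable_uniformization m k R \<longleftrightarrow>
     (\<exists>g. (\<forall>u \<in> Domain R. (u, g u) \<in> R)
        \<and> recognizable m k {(u, g u) | u. u \<in> Domain R})"

fun letter_code :: "nat + nat \<Rightarrow> nat" where
  "letter_code (Inl a) = 2 * a"
| "letter_code (Inr b) = 2 * b + 1"

fun trans_code :: "nat \<times> (nat + nat) \<times> nat \<Rightarrow> nat" where
  "trans_code (p, c, q) = prod_encode (p, prod_encode (letter_code c, q))"

definition nfa_code :: "(nat + nat) nfa \<Rightarrow> nat" where
  "nfa_code A = list_encode [list_encode (map trans_code (trans A)),
                             list_encode (inits A), list_encode (finals A)]"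

end

theory Submission
  imports Defs
begin

text \<open>
  A functional relation that is a finite union of products has a finite image, and conversely a
  finite set of candidate outputs can be distributed over regular sets of inputs. Hence R has a
  recognizable uniformization iff some N bounds, for every input, the length of a shortest output:
  the limitedness problem for the automaton in which a transition costs 1 if it writes and 0
  otherwise.

  A word is abstracted by the relations "cost 0", "bounded cost" and "reachable" between states;
  these labels form a finite semigroup, and for an idempotent label \<open>(z, b, r)\<close> arbitrarily long
  iterations are described by the stabilization \<open>(z, b O z O b, r)\<close>. As in Simon's factorization
  forests, every word is built from letters by concatenations and iterations of one idempotent in a
  number of nested steps that depends only on the size of the semigroup. Each step at most doubles
  the costs, and the stabilized labels that arise are limits of actual words. Therefore a limited
  automaton is limited by an explicit constant. By pumping, this constant has to be checked for
  runs of bounded length only, which is a primitive recursive test.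
\<close>

section \<open>Recursive functions\<close>

text \<open>The obstacle is that iterating an idempotent may change its label, so a word has no
  single value in the label semigroup and factorization by a homomorphism does not apply. The way
  out is an induction on the size of a closed set \<open>T\<close> of labels. A letter
  \<open>a\<close> with \<open>aT \<noteq> T\<close> cuts the word into blocks whose pairwise
  products lie in the smaller set \<open>aT\<close>. If every letter acts bijectively on
  \<open>T\<close>, there are two cases. Either stabilization fixes all idempotent units, and the
  argument by returns to a prefix value works with exact values. Or it moves one of them, and then
  every long enough factor can be pushed into a proper right ideal.

  Labels bound words from two sides: \<open>label_rep\<close> makes the cheap entries of a label
  true for one given word, while \<open>realized\<close> supplies, for every budget, a word with no
  cheap entries beyond those of the label. Only labels with both properties transfer limitedness to
  an explicit constant. The label semigroup itself is never computed; its size merely enters a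
  number, and any computable number above it serves the final search.\<close>

lemma eval_det: "eval f xs r \<Longrightarrow> eval f xs r' \<Longrightarrow> r = r'"
proof (induction arbitrary: r' rule: eval.induct)
  case (eval_Comp ys fs xs g r)
  from eval_Comp.prems obtain zs where zs: "length zs = length fs"
    "\<forall>i<length fs. eval (fs ! i) xs (zs ! i)" "eval g zs r'"
    by (cases rule: eval.cases) auto
  have "ys = zs" using eval_Comp.IH(1) eval_Comp.hyps(1) zs by (auto intro: nth_equalityI)
  then show ?case using eval_Comp.IH(2) zs by blast
next
  case (eval_PrimS f g n xs r s)
  from eval_PrimS.prems obtain t where "eval (Prim f g) (n # xs) t" "eval g (n # t # xs) r'"
    by (cases rule: eval.cases) auto
  then show ?case using eval_PrimS.IH by blast
next
  case (eval_Prim0 f xs r g)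
  from eval_Prim0.prems have "eval f xs r'" by (cases rule: eval.cases) auto
  then show ?case using eval_Prim0.IH by blast
next
  case (eval_Mn f n xs)
  from eval_Mn.prems have a: "eval f (r' # xs) 0" "\<forall>j < r'. \<exists>r. eval f (j # xs) r \<and> r > 0"
    by (cases rule: eval.cases, auto)+
  have "\<not> r' < n" using eval_Mn.IH(2) a(1) by force
  moreover have "\<not> n < r'" using eval_Mn.IH(1) a(2) by force
  ultimately show ?case by simp
qed (auto elim: eval.cases)

section \<open>Functions computed on argument lists of a fixed length\<close>

definition cfn :: "nat \<Rightarrow> (nat list \<Rightarrow> nat) \<Rightarrow> bool" where
  "cfn n F \<longleftrightarrow> (\<exists>r. \<forall>xs. length xs = n \<longrightarrow> eval r xs (F xs))"

lemma cfn_cong: "cfn n F \<Longrightarrow> (\<And>xs. length xs = n \<Longrightarrow> F xs = G xs) \<Longrightarrow> cfn n G"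
  unfolding cfn_def by metis

lemma cfn_proj: "i < n \<Longrightarrow> cfn n (\<lambda>xs. xs ! i)"
  unfolding cfn_def by (rule exI[of _ "Proj i"]) (auto intro: eval.intros)

lemma cfn_zero: "cfn n (\<lambda>xs. 0)"
  unfolding cfn_def by (rule exI[of _ Zero]) (auto intro: eval.intros)

lemma cfn_comp:
  assumes F: "cfn (length Gs) F" and G: "\<And>G. G \<in> set Gs \<Longrightarrow> cfn n G"
  shows "cfn n (\<lambda>xs. F (map (\<lambda>G. G xs) Gs))"
proof -
  obtain rF where rF: "\<And>xs. length xs = length Gs \<Longrightarrow> eval rF xs (F xs)"
    using F unfolding cfn_def by blast
  define rG where "rG G = (SOME r. \<forall>xs. length xs = n \<longrightarrow> eval r xs (G xs))" for G :: "nat list \<Rightarrow> nat"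
  have rG: "eval (rG G) xs (G xs)" if "G \<in> set Gs" "length xs = n" for G xs
    using someI_ex[OF G[OF that(1), unfolded cfn_def]] that(2) unfolding rG_def by blast
  have "eval (Comp rF (map rG Gs)) xs (F (map (\<lambda>G. G xs) Gs))" if "length xs = n" for xs
    by (rule eval_Comp[of "map (\<lambda>G. G xs) Gs"]) (auto intro: rG rF that)
  then show ?thesis unfolding cfn_def by blast
qed

lemma cfn_comp1: "cfn 1 (\<lambda>xs. f (xs ! 0)) \<Longrightarrow> cfn n g \<Longrightarrow> cfn n (\<lambda>xs. f (g xs))"
  using cfn_comp[of "[g]" "\<lambda>xs. f (xs ! 0)" n] by simp

lemma cfn_comp2:
  "cfn 2 (\<lambda>xs. f (xs ! 0) (xs ! 1)) \<Longrightarrow> cfn n g \<Longrightarrow> cfn n h \<Longrightarrow> cfn n (\<lambda>xs. f (g xs) (h xs))"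
  using cfn_comp[of "[g, h]" "\<lambda>xs. f (xs ! 0) (xs ! 1)" n] by (auto simp: numeral_2_eq_2)

lemma cfn_Suc: "cfn n f \<Longrightarrow> cfn n (\<lambda>xs. Suc (f xs))"
  by (rule cfn_comp1[of Suc])
    (auto simp: cfn_def length_Suc_conv intro!: exI[of _ Succ] eval.intros)

lemma cfn_prim:
  assumes "cfn n f" "cfn (Suc (Suc n)) g"
  shows "cfn (Suc n) (\<lambda>xs. rec_nat (f (tl xs)) (\<lambda>i r. g (i # r # tl xs)) (hd xs))"
proof -
  obtain rf rg where rf: "\<And>xs. length xs = n \<Longrightarrow> eval rf xs (f xs)"
    and rg: "\<And>xs. length xs = Suc (Suc n) \<Longrightarrow> eval rg xs (g xs)"
    using assms unfolding cfn_def by blast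
  have "eval (Prim rf rg) (k # xs) (rec_nat (f xs) (\<lambda>i r. g (i # r # xs)) k)" if "length xs = n" for k xs
  proof (induction k)
    case 0 show ?case using rf[OF that] by (auto intro: eval.intros)
  next
    case (Suc k)
    show ?case using eval_PrimS[OF Suc.IH rg] that by auto
  qed
  then show ?thesis unfolding cfn_def by (intro exI[of _ "Prim rf rg"]) (auto simp: length_Suc_conv)
qed

text \<open>\<open>Prim\<close> passes the counter and the previous value before the parameters, so
  the single parameter sits at index 2. Several parameters are later packed into it by
  pairing.\<close>

lemma cfn_rec:
  assumes f: "cfn 1 (\<lambda>xs. f (xs ! 0))"
    and g: "cfn 3 (\<lambda>xs. g (xs ! 2) (xs ! 0) (xs ! 1))"
    and k: "cfn n k" and a: "cfn n a"
  shows "cfn n (\<lambda>xs. rec_nat (f (a xs)) (\<lambda>i r. g (a xs) i r) (k xs))"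
proof -
  have 2: "cfn 2 (\<lambda>xs. rec_nat (f (xs ! 1)) (\<lambda>i r. g (xs ! 1) i r) (xs ! 0))"
    using cfn_prim[of 1 "\<lambda>xs. f (xs ! 0)" "\<lambda>xs. g (xs ! 2) (xs ! 0) (xs ! 1)"] f g
    by (auto simp: numeral_2_eq_2 numeral_3_eq_3 length_Suc_conv elim!: cfn_cong)
  show ?thesis
    using cfn_comp2[OF 2, of n k a] k a by simp
qed

lemma cfn_add: "cfn n f \<Longrightarrow> cfn n g \<Longrightarrow> cfn n (\<lambda>xs. f xs + g xs)"
proof -
  assume a: "cfn n f" "cfn n g"
  have *: "rec_nat y (\<lambda>_. Suc) x = x + y" for x y :: nat by (induction x) auto
  show ?thesis
    using cfn_rec[of "\<lambda>x. x" "\<lambda>_ _ r. Suc r" n f g, OF cfn_proj cfn_Suc[OF cfn_proj] a] by (simp add: *)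
qed

lemma cfn_pred: "cfn n f \<Longrightarrow> cfn n (\<lambda>xs. f xs - 1)"
proof -
  assume a: "cfn n f"
  have *: "rec_nat 0 (\<lambda>i r. i) x = x - 1" for x :: nat by (induction x) auto
  show ?thesis
    using cfn_rec[of "\<lambda>x. 0" "\<lambda>_ i r. i" n f f, OF cfn_zero cfn_proj a a] by (simp add: *)
qed

lemma cfn_diff: "cfn n f \<Longrightarrow> cfn n g \<Longrightarrow> cfn n (\<lambda>xs. f xs - g xs)"
proof -
  assume a: "cfn n f" "cfn n g"
  have *: "rec_nat y (\<lambda>_ r. r - 1) x = y - x" for x y :: nat by (induction x) auto
  show ?thesis
    using cfn_rec[of "\<lambda>x. x" "\<lambda>_ _ r. r - 1" n g f, OF cfn_proj cfn_pred[OF cfn_proj] a(2,1)]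
    by (simp add: * del: One_nat_def)
qed

lemma cfn_if: "cfn n c \<Longrightarrow> cfn n f \<Longrightarrow> cfn n g \<Longrightarrow> cfn n (\<lambda>xs. if c xs = 0 then f xs else g xs)"
proof -
  assume a: "cfn n c" "cfn n f" "cfn n g"
  have *: "rec_nat y (\<lambda>_ r. r) x = y" for x y :: nat by (induction x) auto
  have 1: "cfn 2 (\<lambda>xs. if xs ! 0 = 0 then xs ! 1 else 0)"
  proof -
    have *: "rec_nat y (\<lambda>_ r. 0) x = (if x = 0 then y else 0)" for x y :: nat by (cases x) auto
    show ?thesis
      using cfn_rec[of "\<lambda>x. x" "\<lambda>_ _ r. 0" 2 "\<lambda>xs. xs ! 0" "\<lambda>xs. xs ! 1", OF cfn_proj cfn_zero cfn_proj cfn_proj]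
      by (simp add: * cong: if_cong)
  qed
  \<comment> \<open>Each branch is cut off to 0 by a test for zero, this one by testing
    \<open>1 - c xs\<close>; the sum of the two is the conditional.\<close>
  have 2: "cfn n (\<lambda>xs. if 1 - c xs = 0 then g xs else 0)"
    using cfn_comp2[of "\<lambda>x y. if x = 0 then y else 0" n "\<lambda>xs. 1 - c xs" g] 1 a
      cfn_diff[OF cfn_Suc[OF cfn_zero] a(1)] by simp
  have 3: "cfn n (\<lambda>xs. if c xs = 0 then f xs else 0)"
    using cfn_comp2[of "\<lambda>x y. if x = 0 then y else 0" n c f] 1 a by simp
  show ?thesis by (rule cfn_cong[OF cfn_add[OF 2 3]]) auto
qed

lemma cfn_triangle: "cfn n f \<Longrightarrow> cfn n (\<lambda>xs. triangle (f xs))"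
proof -
  assume a: "cfn n f"
  have *: "rec_nat 0 (\<lambda>i r. r + Suc i) x = triangle x" for x :: nat by (induction x) auto
  show ?thesis
    using cfn_rec[of "\<lambda>x. 0" "\<lambda>_ i r. r + Suc i" n f f, OF cfn_zero cfn_add[OF cfn_proj cfn_Suc[OF cfn_proj]] a a]
    by (simp add: * del: add_Suc_right)
qed

text \<open>The pairing and its projections, as constants on which the computability rules match.\<close>
definition pp :: "nat \<Rightarrow> nat \<Rightarrow> nat" where "pp x y = prod_encode (x, y)"
definition pf :: "nat \<Rightarrow> nat" where "pf z = fst (prod_decode z)"
definition ps :: "nat \<Rightarrow> nat" where "ps z = snd (prod_decode z)"

lemma pp_simps [simp]: "pf (pp x y) = x" "ps (pp x y) = y" "pp (pf z) (ps z) = z"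
  by (simp_all add: pp_def pf_def ps_def)

lemma cfn_pp: "cfn n f \<Longrightarrow> cfn n g \<Longrightarrow> cfn n (\<lambda>xs. pp (f xs) (g xs))"
  unfolding pp_def prod_encode_def by (simp add: cfn_add cfn_triangle)

text \<open>The index of the Cantor diagonal that contains z.\<close>
definition diag :: "nat \<Rightarrow> nat" where
  "diag z = rec_nat 0 (\<lambda>i r. if triangle (Suc r) - Suc i = 0 then Suc r else r) z"

lemma diag_bounds: "triangle (diag z) \<le> z \<and> z < triangle (Suc (diag z))"
  by (induction z) (auto simp: diag_def)

lemma triangle_mono: "x \<le> y \<Longrightarrow> triangle x \<le> triangle y"
  by (rule lift_Suc_mono_le[of triangle]) auto

text \<open>A pair with sum s is coded between \<open>triangle s\<close> and
  \<open>triangle (Suc s)\<close>, and these intervals are disjoint. So \<open>diag\<close> recovers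
  the sum, and both projections become differences of computable functions.\<close>

lemma diag_pp: "diag (pp x y) = x + y"
proof -
  have 1: "triangle (x + y) \<le> pp x y" "pp x y < triangle (Suc (x + y))"
    by (auto simp: pp_def prod_encode_def)
  have 2: "triangle (diag (pp x y)) \<le> pp x y" "pp x y < triangle (Suc (diag (pp x y)))"
    using diag_bounds by blast+
  show ?thesis
  proof (rule ccontr)
    assume "diag (pp x y) \<noteq> x + y"
    then consider "Suc (diag (pp x y)) \<le> x + y" | "Suc (x + y) \<le> diag (pp x y)" by linarith
    then show False using triangle_mono 1 2 by cases (meson leD le_trans)+
  qed
qed

lemma pf_eq: "pf z = z - triangle (diag z)"
proof -
  obtain x y where z: "z = pp x y" using pp_simps(3) by metis
  show ?thesis unfolding z diag_pp pp_simps by (simp add: pp_def prod_encode_def)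
qed

lemma ps_eq: "ps z = diag z - pf z"
  using diag_pp[of "pf z" "ps z"] by simp

lemma cfn_diag: "cfn n f \<Longrightarrow> cfn n (\<lambda>xs. diag (f xs))"
  unfolding diag_def
  by (rule cfn_rec[of "\<lambda>_. 0" "\<lambda>_ i r. if triangle (Suc r) - Suc i = 0 then Suc r else r"])
    (intro cfn_if cfn_diff cfn_triangle cfn_Suc cfn_proj cfn_zero; simp)+

lemma cfn_pf: "cfn n f \<Longrightarrow> cfn n (\<lambda>xs. pf (f xs))"
  unfolding pf_eq by (intro cfn_diff cfn_triangle cfn_diag)

lemma cfn_ps: "cfn n f \<Longrightarrow> cfn n (\<lambda>xs. ps (f xs))"
  unfolding ps_eq by (intro cfn_diff cfn_pf cfn_diag)

section \<open>Unary functions and predicates, with several arguments packed by pairing\<close>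

definition cf :: "(nat \<Rightarrow> nat) \<Rightarrow> bool" where
  "cf f \<longleftrightarrow> cfn 1 (\<lambda>xs. f (xs ! 0))"

lemma cfI: "(\<And>n a. cfn n a \<Longrightarrow> cfn n (\<lambda>xs. f (a xs))) \<Longrightarrow> cf f"
  unfolding cf_def by (simp add: cfn_proj)

lemma cf_id: "cf (\<lambda>x. x)"
  by (rule cfI)

lemma cf_const: "cf (\<lambda>x. c)"
  unfolding cf_def by (induction c) (auto intro: cfn_zero cfn_Suc)

lemma cf_Suc: "cf f \<Longrightarrow> cf (\<lambda>x. Suc (f x))"
  unfolding cf_def by (rule cfn_Suc)

lemma cf_add: "cf f \<Longrightarrow> cf g \<Longrightarrow> cf (\<lambda>x. f x + g x)"
  unfolding cf_def by (rule cfn_add)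

lemma cf_diff: "cf f \<Longrightarrow> cf g \<Longrightarrow> cf (\<lambda>x. f x - g x)"
  unfolding cf_def by (rule cfn_diff)

lemma cf_pp: "cf f \<Longrightarrow> cf g \<Longrightarrow> cf (\<lambda>x. pp (f x) (g x))"
  unfolding cf_def by (rule cfn_pp)

lemma cf_pf: "cf f \<Longrightarrow> cf (\<lambda>x. pf (f x))"
  unfolding cf_def by (rule cfn_pf)

lemma cf_ps: "cf f \<Longrightarrow> cf (\<lambda>x. ps (f x))"
  unfolding cf_def by (rule cfn_ps)

lemma cf_comp: "cf f \<Longrightarrow> cf g \<Longrightarrow> cf (\<lambda>x. f (g x))"
  unfolding cf_def by (rule cfn_comp1)

lemma cf_rec:
  assumes k: "cf k" and f: "cf f" and g: "cf (\<lambda>z. g (pf z) (pf (ps z)) (ps (ps z)))"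
  shows "cf (\<lambda>x. rec_nat (f x) (\<lambda>i r. g x i r) (k x))"
proof -
  have "cfn 3 (\<lambda>xs. pp (xs ! 2) (pp (xs ! 0) (xs ! 1)))"
    by (intro cfn_pp cfn_proj) auto
  from cfn_comp1[OF g[unfolded cf_def] this]
  have "cfn 3 (\<lambda>xs. g (xs ! 2) (xs ! 0) (xs ! 1))" by simp
  from cfn_rec[OF f[unfolded cf_def] this k[unfolded cf_def], of "\<lambda>xs. xs ! 0"]
  show ?thesis unfolding cf_def by (simp add: cfn_proj)
qed

lemma cf_mult: "cf f \<Longrightarrow> cf g \<Longrightarrow> cf (\<lambda>x. f x * g x)"
proof -
  assume a: "cf f" "cf g"
  have *: "rec_nat 0 (\<lambda>_ r. y + r) x = x * y" for x y :: nat by (induction x) auto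
  have "cf (\<lambda>x. rec_nat 0 (\<lambda>_ r. g x + r) (f x))"
    by (intro cf_rec a cf_const cf_add cf_comp[OF a(2)] cf_pf cf_ps cf_id)
  then show ?thesis by (simp add: *)
qed

lemma cf_power: "cf f \<Longrightarrow> cf g \<Longrightarrow> cf (\<lambda>x. f x ^ g x)"
proof -
  assume a: "cf f" "cf g"
  have *: "rec_nat 1 (\<lambda>_ r. y * r) x = y ^ x" for x y :: nat by (induction x) auto
  have "cf (\<lambda>x. rec_nat 1 (\<lambda>_ r. f x * r) (g x))"
    by (intro cf_rec a cf_const cf_mult cf_comp[OF a(1)] cf_pf cf_ps cf_id)
  then show ?thesis by (simp only: *)
qed

definition cp :: "(nat \<Rightarrow> bool) \<Rightarrow> bool" where
  "cp P \<longleftrightarrow> cf (\<lambda>x. if P x then 1 else 0)"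

lemma cf_if:
  assumes "cp P" "cf f" "cf g"
  shows "cf (\<lambda>x. if P x then f x else g x)"
proof -
  have "cf (\<lambda>x. if (if P x then 1 else 0) = (0::nat) then g x else f x)"
    using assms unfolding cf_def cp_def by (intro cfn_if) auto
  then show ?thesis by (rule back_subst[of cf]) auto
qed

lemma cp_eq0: "cf f \<Longrightarrow> cp (\<lambda>x. f x = 0)"
  unfolding cp_def cf_def
  using cfn_if[of 1 "\<lambda>xs. f (xs ! 0)" "\<lambda>_. 1" "\<lambda>_. 0"] cfn_Suc[OF cfn_zero] cfn_zero by simp

lemma cp_le: "cf f \<Longrightarrow> cf g \<Longrightarrow> cp (\<lambda>x. f x \<le> g x)"
  using cp_eq0[OF cf_diff[of f g]] by simp

lemma cp_conj: "cp P \<Longrightarrow> cp Q \<Longrightarrow> cp (\<lambda>x. P x \<and> Q x)"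
  using cf_if[of P "\<lambda>x. if Q x then 1 else 0" "\<lambda>_. 0"] cf_const unfolding cp_def
  by (simp add: if_if_eq_conj cong: if_cong)

lemma if_not_P_swap: "(if \<not> P then x else y) = (if P then y else x)"
  by simp

lemma cp_not: "cp P \<Longrightarrow> cp (\<lambda>x. \<not> P x)"
  using cf_if[of P "\<lambda>_. 0" "\<lambda>_. 1"] cf_const unfolding cp_def if_not_P_swap by simp

lemma cp_imp: "cp P \<Longrightarrow> cp Q \<Longrightarrow> cp (\<lambda>x. P x \<longrightarrow> Q x)"
  using cp_not[OF cp_conj[OF _ cp_not, of P Q]] by simp

lemma cp_eq: "cf f \<Longrightarrow> cf g \<Longrightarrow> cp (\<lambda>x. f x = g x)"
  using cp_conj[OF cp_le cp_le, of f g g f] by (simp add: eq_iff)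

lemma cp_comp: "cp P \<Longrightarrow> cf g \<Longrightarrow> cp (\<lambda>x. P (g x))"
  unfolding cp_def by (rule cf_comp)

lemma cp_all:
  assumes P: "cp (\<lambda>z. P (pf z) (ps z))" and k: "cf k"
  shows "cp (\<lambda>x. \<forall>y<k x. P x y)"
proof -
  have *: "rec_nat 1 (\<lambda>i r. if P x i then r else 0) n = (if \<forall>y<n. P x y then 1 else 0)" for x and n :: nat
    by (induction n) (auto simp: less_Suc_eq)
  have "cf (\<lambda>x. rec_nat 1 (\<lambda>i r. if P x i then r else 0) (k x))"
  proof (rule cf_rec[OF k cf_const], rule cf_if)
    have "cf (\<lambda>z. pp (pf z) (pf (ps z)))" by (intro cf_pp cf_pf cf_ps cf_id)
    from cp_comp[OF P this] show "cp (\<lambda>z. P (pf z) (pf (ps z)))" by simp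
  qed (intro cf_ps cf_id cf_const)+
  then show ?thesis unfolding cp_def * .
qed

lemma cp_ex:
  assumes P: "cp (\<lambda>z. P (pf z) (ps z))" and k: "cf k"
  shows "cp (\<lambda>x. \<exists>y<k x. P x y)"
  using cp_not[OF cp_all[OF cp_not[OF P] k]] by simp

text \<open>The recursion runs on pairs of the accumulator and the code of the unread rest. It makes
  \<open>l x\<close> steps, which suffices because a list is no longer than its code, and it idles
  once the rest is empty.\<close>

lemma cf_foldl:
  assumes g: "cf (\<lambda>z. g (pf z) (pf (ps z)) (ps (ps z)))" and s: "cf s" and l: "cf l"
  shows "cf (\<lambda>x. foldl (g x) (s x) (list_decode (l x)))"
proof -
  \<comment> \<open>A nonempty list is coded by the successor of a pair of head and coded tail,
    hence the subtractions of 1.\<close>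
  define st where "st x r = (if ps r = 0 then r
    else pp (g x (pf r) (pf (ps r - 1))) (ps (ps r - 1)))" for x r
  have step: "rec_nat (pp a (list_encode zs)) (\<lambda>_. st x) n = pp (foldl (g x) a zs) 0"
    if "length zs \<le> n" for x a zs n
  proof -
    have "rec_nat (pp a (list_encode zs)) (\<lambda>_. st x) n
        = pp (foldl (g x) a (take n zs)) (list_encode (drop n zs))" for n
    proof (induction n)
      case (Suc n)
      show ?case
      proof (cases "drop n zs")
        case Nil
        then have "take (Suc n) zs = take n zs" "drop (Suc n) zs = []" by auto
        then show ?thesis using Suc Nil by (simp add: st_def)
      next
        case (Cons z ys)
        then have "n < length zs" by (metis drop_eq_Nil leI list.distinct(1))
        then have "take (Suc n) zs = take n zs @ [z]" "drop (Suc n) zs = ys"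
          using Cons by (metis nth_via_drop take_Suc_conv_app_nth, metis Cons drop_Suc tl_drop list.sel(3))
        then show ?thesis using Suc Cons by (simp add: st_def flip: pp_def)
      qed
    qed simp
    then show ?thesis using that by simp
  qed
  have len: "length zs \<le> list_encode zs" for zs
    by (induction zs) (auto intro: order_trans le_prod_encode_2)
  have "cf (\<lambda>z. g (pf z) (pf (ps (ps z))) (pf (ps (ps (ps z)) - 1)))"
  proof -
    have "cf (\<lambda>z. pp (pf z) (pp (pf (ps (ps z))) (pf (ps (ps (ps z)) - 1))))"
      by (intro cf_pp cf_pf cf_ps cf_id cf_diff cf_const)
    from cf_comp[OF g this] show ?thesis by simp
  qed
  then have "cf (\<lambda>x. rec_nat (pp (s x) (l x)) (\<lambda>_. st x) (l x))"
    unfolding st_def by (intro cf_rec cf_if cf_pp cf_pf cf_ps cf_id cf_diff cf_const cp_eq0 s l)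
  then have "cf (\<lambda>x. pf (rec_nat (pp (s x) (l x)) (\<lambda>_. st x) (l x)))" by (rule cf_pf)
  moreover have "rec_nat (pp (s x) (l x)) (\<lambda>_. st x) (l x) = pp (foldl (g x) (s x) (list_decode (l x))) 0" for x
    using step[of "list_decode (l x)" "l x"] len[of "list_decode (l x)"] by simp
  ultimately show ?thesis by simp
qed

lemma cp_mem:
  assumes "cf z" "cf l" shows "cp (\<lambda>x. z x \<in> set (list_decode (l x)))"
proof -
  have *: "foldl (\<lambda>a y. if y = z then 1 else a) i ys = (if z \<in> set ys then 1 else i)" for z i :: nat and ys
    by (induction ys arbitrary: i) auto
  have "cf (\<lambda>x. foldl (\<lambda>a y. if y = z x then 1 else a) 0 (list_decode (l x)))"
    by (intro cf_foldl assms cf_if cp_eq cf_pf cf_ps cf_id cf_const cf_comp[OF assms(1)])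
  then show ?thesis unfolding cp_def * .
qed

section \<open>Factorizations of bounded height\<close>

text \<open>The recursion mirrors \<open>bounded_factorization\<close>: for \<open>Suc s\<close>
  labels there are at most \<open>Suc s\<close> rounds, each adding one call for a smaller set and
  \<open>4 * Suc s + 10\<close> levels for gluing or for the bijective case.\<close>

fun height_bound :: "nat \<Rightarrow> nat" where
  "height_bound 0 = 0"
| "height_bound (Suc s) = Suc s * (height_bound s + 4 * Suc s + 10)"

text \<open>\<open>rep h u c\<close> is read as: \<open>u\<close> has a factorization of height
  \<open>h\<close> with label \<open>c\<close>. A word may have several labels.
  \<open>rep_sharp\<close> joins any positive number of factors in one level, which is why the
  height can stay bounded. \<open>sharp_swap\<close> is what the usual law
  \<open>(x y)^# x = x (y x)^#\<close> gives for \<open>x = f\<close> and \<open>y = e\<close>,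
  combined with \<open>sharp_left\<close>.\<close>

locale stabilization = semigroup mul
  for mul :: "'s \<Rightarrow> 's \<Rightarrow> 's" (infixl "\<cdot>" 70) +
  fixes S :: "'s set" and sharp :: "'s \<Rightarrow> 's" and rep :: "nat \<Rightarrow> 'w list \<Rightarrow> 's \<Rightarrow> bool"
  assumes sharp_left: "e \<cdot> e = e \<Longrightarrow> e \<in> S \<Longrightarrow> e \<cdot> sharp e = sharp e"
    and sharp_right: "e \<cdot> e = e \<Longrightarrow> e \<in> S \<Longrightarrow> sharp e \<cdot> e = sharp e"
    and sharp_idem: "e \<cdot> e = e \<Longrightarrow> e \<in> S \<Longrightarrow> sharp e \<cdot> sharp e = sharp e"
    and sharp_swap: "e \<in> S \<Longrightarrow> f \<in> S \<Longrightarrow> e \<cdot> e = e \<Longrightarrow> f \<cdot> f = f \<Longrightarrow> e \<cdot> f = f \<Longrightarrow> f \<cdot> e = e \<Longrightarrow>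
      sharp f = sharp e \<cdot> f"
    and rep_Suc: "rep h u c \<Longrightarrow> rep (Suc h) u c"
    and rep_mul: "rep h u c \<Longrightarrow> rep h v d \<Longrightarrow> rep (Suc h) (u @ v) (c \<cdot> d)"
    and rep_sharp: "us \<noteq> [] \<Longrightarrow> \<forall>u\<in>set us. rep h u e \<Longrightarrow> e \<cdot> e = e \<Longrightarrow> e \<in> S \<Longrightarrow>
      rep (Suc h) (concat us) (sharp e)"
begin

definition closed :: "'s set \<Rightarrow> bool" where
  "closed T \<longleftrightarrow> T \<subseteq> S \<and> finite T \<and> (\<forall>x\<in>T. \<forall>y\<in>T. x \<cdot> y \<in> T) \<and> (\<forall>e\<in>T. e \<cdot> e = e \<longrightarrow> sharp e \<in> T)"

abbreviation cw :: "('w list \<times> 's) list \<Rightarrow> 'w list" where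
  "cw xs \<equiv> concat (map fst xs)"

definition items :: "nat \<Rightarrow> 's set \<Rightarrow> ('w list \<times> 's) list \<Rightarrow> bool" where
  "items h X xs \<longleftrightarrow> (\<forall>(u, c) \<in> set xs. c \<in> X \<and> rep h u c)"

text \<open>The semigroup need not have a neutral element, so the empty list gets no value; this
  causes the nonemptiness conditions below.\<close>

fun val :: "('w list \<times> 's) list \<Rightarrow> 's" where
  "val [] = undefined"
| "val [x] = snd x"
| "val (x # y # xs) = snd x \<cdot> val (y # xs)"

lemma val_Cons: "xs \<noteq> [] \<Longrightarrow> val (x # xs) = snd x \<cdot> val xs"
  by (cases xs) auto

lemma val_append: "xs \<noteq> [] \<Longrightarrow> ys \<noteq> [] \<Longrightarrow> val (xs @ ys) = val xs \<cdot> val ys"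
proof (induction xs)
  case (Cons x xs)
  then show ?case by (cases "xs = []") (auto simp: val_Cons assoc)
qed simp

lemma val_in:
  assumes "\<forall>x\<in>X. \<forall>y\<in>X. x \<cdot> y \<in> X" "xs \<noteq> []" "items h X xs"
  shows "val xs \<in> X"
  using assms(2,3)
proof (induction xs)
  case (Cons x xs)
  then show ?case using assms(1) by (cases "xs = []") (auto simp: val_Cons items_def)
qed simp

lemma rep_mono:
  assumes "rep h u c" "h \<le> h'" shows "rep h' u c"
  using assms(2,1) by (induction rule: dec_induct) (auto intro: rep_Suc)

lemma rep_mul': "rep h u c \<Longrightarrow> rep h v d \<Longrightarrow> h < h' \<Longrightarrow> rep h' (u @ v) (c \<cdot> d)"
  using rep_mono[OF rep_mul] by simp

lemma items_mono: "items h X xs \<Longrightarrow> X \<subseteq> Y \<Longrightarrow> h \<le> h' \<Longrightarrow> items h' Y xs"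
  unfolding items_def by (auto intro: rep_mono)

lemma items_append [simp]: "items h X (xs @ ys) \<longleftrightarrow> items h X xs \<and> items h X ys"
  by (auto simp: items_def)

lemma items_Cons [simp]: "items h X (x # xs) \<longleftrightarrow> snd x \<in> X \<and> rep h (fst x) (snd x) \<and> items h X xs"
  by (auto simp: items_def)

lemma items_Nil [simp]: "items h X []"
  by (auto simp: items_def)

lemma rep_list: "items h X xs \<Longrightarrow> xs \<noteq> [] \<Longrightarrow> rep (h + length xs) (cw xs) (val xs)"
proof (induction xs)
  case (Cons x xs)
  have 1: "rep (h + length xs) (fst x) (snd x)" using Cons.prems by (auto intro: rep_mono)
  show ?case
  proof (cases "xs = []")
    case True
    then show ?thesis using 1 by (auto intro: rep_Suc)
  next
    case False
    then show ?thesis using Cons rep_mul[OF 1] by (auto simp: val_Cons)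
  qed
qed simp

section \<open>Removing a letter that maps the semigroup onto a proper right ideal\<close>

definition covered :: "'s set \<Rightarrow> nat \<Rightarrow> 's set \<Rightarrow> nat \<Rightarrow> bool" where
  "covered X h T h' \<longleftrightarrow> (\<forall>xs. xs \<noteq> [] \<longrightarrow> items h X xs \<longrightarrow> (\<exists>c\<in>T. rep h' (cw xs) c))"

text \<open>For an idempotent \<open>e = a \<cdot> t\<close> also
  \<open>sharp e = e \<cdot> sharp e = a \<cdot> (t \<cdot> sharp e)\<close>. Thus the induction on
  the size may continue with \<open>aT\<close>.\<close>

lemma closed_left_ideal:
  assumes T: "closed T" and a: "a \<in> T"
  shows "closed ((\<lambda>t. a \<cdot> t) ` T)"
  unfolding closed_def
proof (intro conjI ballI impI)
  show "(\<lambda>t. a \<cdot> t) ` T \<subseteq> S" "finite ((\<lambda>t. a \<cdot> t) ` T)" using T a by (auto simp: closed_def)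
next
  fix x y assume "x \<in> (\<lambda>t. a \<cdot> t) ` T" "y \<in> (\<lambda>t. a \<cdot> t) ` T"
  then show "x \<cdot> y \<in> (\<lambda>t. a \<cdot> t) ` T" using T a by (auto simp: closed_def assoc)
next
  fix e assume e: "e \<in> (\<lambda>t. a \<cdot> t) ` T" "e \<cdot> e = e"
  then obtain t where t: "t \<in> T" "e = a \<cdot> t" by auto
  have eT: "e \<in> T" using t T a by (auto simp: closed_def)
  then have "sharp e = a \<cdot> (t \<cdot> sharp e)"
    using sharp_left[OF e(2)] t T by (auto simp: closed_def subset_iff assoc)
  moreover have "t \<cdot> sharp e \<in> T" using eT e(2) t T by (auto simp: closed_def)
  ultimately show "sharp e \<in> (\<lambda>t. a \<cdot> t) ` T" by blast
qed

text \<open>A single item may have the label a, which need not lie in \<open>aT\<close>; the product of two items always does.\<close>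
lemma pairing:
  assumes T: "closed T" and a: "a \<in> T"
    and "items h (insert a ((\<lambda>t. a \<cdot> t) ` T)) bs"
  shows "\<exists>b ps. length b \<le> 1 \<and> (bs \<noteq> [] \<longrightarrow> b \<noteq> [] \<or> ps \<noteq> []) \<and> cw bs = cw b @ cw ps \<and> items h T b \<and> items (Suc h) ((\<lambda>t. a \<cdot> t) ` T) ps"
  using assms(3)
proof (induction bs rule: induct_list012)
  case 1
  show ?case by (intro exI[of _ "[]"]) simp
next
  case (2 x)
  then show ?case using T a by (intro exI[of _ "[x]"] exI[of _ "[]"]) (auto simp: closed_def)
next
  case (3 x y bs)
  then obtain b ps where b: "length b \<le> 1" "cw bs = cw b @ cw ps" "items h T b"
    "items (Suc h) ((\<lambda>t. a \<cdot> t) ` T) ps" by auto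
  have ab: "c \<cdot> d \<in> (\<lambda>t. a \<cdot> t) ` T" if "c \<in> insert a ((\<lambda>t. a \<cdot> t) ` T)" "d \<in> T" for c d
    using that T a by (auto simp: closed_def assoc)
  have inT: "c \<in> T" if "c \<in> insert a ((\<lambda>t. a \<cdot> t) ` T)" for c
    using that T a by (auto simp: closed_def)
  show ?case
  proof (cases b)
    case Nil
    show ?thesis
      by (rule exI[of _ "[]"], rule exI[of _ "(fst x @ fst y, snd x \<cdot> snd y) # ps"])
        (use 3 b Nil ab inT in \<open>auto intro: rep_mul simp del: insert_iff\<close>)
  next
    case (Cons z zs)
    show ?thesis
      by (rule exI[of _ "[x]"], rule exI[of _ "(fst y @ fst z, snd y \<cdot> snd z) # ps"])
        (use 3 b Cons ab inT in \<open>auto intro: rep_mul simp del: insert_iff\<close>)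
  qed
qed

text \<open>The list is cut in front of every occurrence of \<open>a\<close>. A block is
  \<open>a\<close> followed by an \<open>a\<close>-free list, which has a label in \<open>T\<close>
  by \<open>cov\<close> unless it is empty; so the block has label \<open>a\<close> or a label in
  \<open>aT\<close>.\<close>

lemma split_at_letter:
  assumes T: "closed T" and a: "a \<in> X" "X \<subseteq> T"
    and cov: "covered (X - {a}) h T h'" and h: "h \<le> h'"
    and "items h X xs"
  shows "\<exists>v bs. xs = v @ concat bs \<and> items h (X - {a}) v \<and>
    (\<exists>bs'. map fst bs' = map cw bs \<and> items (Suc h') (insert a ((\<lambda>t. a \<cdot> t) ` T)) bs')"
  using assms(6)
proof (induction xs)
  case Nil
  show ?case by (intro exI[of _ "[]"]) auto
next
  case (Cons x xs)
  then obtain v bs bs' where v: "xs = v @ concat bs" "items h (X - {a}) v"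
    "map fst bs' = map cw bs" "items (Suc h') (insert a ((\<lambda>t. a \<cdot> t) ` T)) bs'"
    by auto
  show ?case
  proof (cases "snd x = a")
    case False
    then show ?thesis using v Cons.prems by (intro exI[of _ "x # v"] exI[of _ bs]) auto
  next
    case True
    obtain c where c: "c \<in> insert a ((\<lambda>t. a \<cdot> t) ` T)" "rep (Suc h') (cw (x # v)) c"
    proof (cases "v = []")
      case True
      moreover have "rep (Suc h') (fst x) (snd x)"
        using Cons.prems h by (auto intro: rep_mono[of h])
      ultimately show ?thesis using that[of a] \<open>snd x = a\<close> by simp
    next
      case False
      then obtain d where "d \<in> T" "rep h' (cw v) d" using cov v(2) unfolding covered_def by blast
      then show ?thesis using that[of "a \<cdot> d"] \<open>snd x = a\<close> Cons.prems h
        by (auto intro!: rep_mul intro: rep_mono)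
    qed
    show ?thesis
      by (rule exI[of _ "[]"], rule exI[of _ "(x # v) # bs"], intro conjI exI[of _ "(cw (x # v), c) # bs'"])
        (use v c in auto)
  qed
qed

text \<open>Paired blocks have labels in \<open>aT\<close>, where \<open>ideal\<close> applies. The
  two final successors attach a possible odd block and the \<open>a\<close>-free prefix.\<close>

lemma covered_shrinking_letter:
  assumes T: "closed T" and a: "a \<in> X" "X \<subseteq> T"
    and cov: "covered (X - {a}) h T h'" and h: "h \<le> h'"
    and ideal: "covered ((\<lambda>t. a \<cdot> t) ` T) (Suc (Suc h')) ((\<lambda>t. a \<cdot> t) ` T) h''" and h': "Suc h' \<le> h''"
  shows "covered X h T (Suc (Suc h''))"
  unfolding covered_def
proof (intro allI impI)
  fix xs assume xs: "xs \<noteq> []" "items h X xs"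
  have TT: "x \<cdot> y \<in> T" if "x \<in> T" "y \<in> T" for x y using T that by (auto simp: closed_def)
  have aT: "(\<lambda>t. a \<cdot> t) ` T \<subseteq> T" using a TT by auto
  from split_at_letter[OF T a cov h xs(2)] obtain v bs bs' where v: "xs = v @ concat bs" "items h (X - {a}) v"
    and bs: "map fst bs' = map cw bs" "items (Suc h') (insert a ((\<lambda>t. a \<cdot> t) ` T)) bs'" by blast
  from pairing[OF T _ bs(2)] a obtain b ps where b: "length b \<le> 1" "bs' \<noteq> [] \<longrightarrow> b \<noteq> [] \<or> ps \<noteq> []" "cw bs' = cw b @ cw ps"
    "items (Suc h') T b" "items (Suc (Suc h')) ((\<lambda>t. a \<cdot> t) ` T) ps" by auto
  have eq: "cw (concat bs) = cw bs'"
    unfolding bs(1) by (induction bs) auto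
  have 1: "v = [] \<or> (\<exists>c\<in>T. rep h' (cw v) c)"
    using cov v(2) unfolding covered_def by blast
  have 2: "b = [] \<or> (\<exists>c\<in>T. rep (Suc h') (cw b) c)"
    using b(1,4) by (cases b) auto
  have 3: "ps = [] \<or> (\<exists>c\<in>T. rep h'' (cw ps) c)"
    using ideal b(5) aT unfolding covered_def by blast
  have "bs' \<noteq> [] \<or> v \<noteq> []" using xs(1) v(1) bs(1) by auto
  then have ne: "v \<noteq> [] \<or> b \<noteq> [] \<or> ps \<noteq> []" using b(2) by auto
  have ext: "\<exists>c\<in>T. rep (Suc l) (p @ q) c"
    if "\<exists>c\<in>T. rep l p c" "q = [] \<or> (\<exists>c\<in>T. rep l q c)" for l p q
    using that TT rep_mul[of l p _ q] rep_Suc by (metis append.right_neutral)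
  have mono: "\<exists>c\<in>T. rep l' p c" if "\<exists>c\<in>T. rep l p c" "l \<le> l'" for l l' p
    using that rep_mono by blast
  have "cw xs = cw v @ cw b @ cw ps" using v(1) eq b(3) by simp
  moreover have "b @ ps = [] \<or> (\<exists>c\<in>T. rep (Suc h'') (cw b @ cw ps) c)"
    using ext[of h'' "cw b" "cw ps"] mono[of "Suc h'" "cw b" h''] mono[of h'' "cw ps" "Suc h''"] 2 3 h'
    by (cases "b = []") auto
  ultimately show "\<exists>c\<in>T. rep (Suc (Suc h'')) (cw xs) c"
    using ne 1 h' ext[of "Suc h''" "cw v" "cw b @ cw ps"] mono[of h' "cw v" "Suc h''"]
      mono[of "Suc h''" "cw b @ cw ps" "Suc (Suc h'')"] by (cases "v = []") auto
qed

text \<open>The elements of \<open>T\<close> that act bijectively on \<open>T\<close> form a right group: the product of a factor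
  that returns to the prefix value q is an idempotent determined by q, and any two
  idempotents e, f satisfy \<open>e f = f\<close>.\<close>
definition units :: "'s set \<Rightarrow> 's set" where
  "units T = {g \<in> T. (\<lambda>t. g \<cdot> t) ` T = T}"

section \<open>Letters that act bijectively\<close>

context
  fixes T assumes T: "closed T"
begin

lemma mul_T: "x \<in> T \<Longrightarrow> y \<in> T \<Longrightarrow> x \<cdot> y \<in> T"
  using T by (auto simp: closed_def)

lemma T_S: "x \<in> T \<Longrightarrow> x \<in> S"
  using T by (auto simp: closed_def)

lemma units_T: "g \<in> units T \<Longrightarrow> g \<in> T"
  by (simp add: units_def)

text \<open>On a finite set the surjective left translation by a unit is also injective.\<close>

lemma units_cancel: "g \<in> units T \<Longrightarrow> x \<in> T \<Longrightarrow> y \<in> T \<Longrightarrow> g \<cdot> x = g \<cdot> y \<Longrightarrow> x = y"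
  using T eq_card_imp_inj_on[of T "\<lambda>t. g \<cdot> t"] unfolding units_def closed_def inj_on_def by auto

lemma units_mul: "g \<in> units T \<Longrightarrow> h \<in> units T \<Longrightarrow> g \<cdot> h \<in> units T"
proof -
  assume a: "g \<in> units T" "h \<in> units T"
  have "(\<lambda>t. (g \<cdot> h) \<cdot> t) ` T = (\<lambda>t. g \<cdot> t) ` (\<lambda>t. h \<cdot> t) ` T"
    by (simp add: image_image assoc)
  also have "\<dots> = T" using a by (simp add: units_def)
  finally show ?thesis using a mul_T by (simp add: units_def)
qed

lemma unit_idem_left: "e \<in> units T \<Longrightarrow> e \<cdot> e = e \<Longrightarrow> t \<in> T \<Longrightarrow> e \<cdot> t = t"
  using units_cancel[of e "e \<cdot> t" t] mul_T units_T by (simp flip: assoc)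

lemma unit_return: "q \<in> units T \<Longrightarrow> y \<in> T \<Longrightarrow> q \<cdot> y = q \<Longrightarrow> y \<cdot> y = y"
  using units_cancel[of q "y \<cdot> y" y] mul_T by (simp flip: assoc)

lemma val_units: "xs \<noteq> [] \<Longrightarrow> items h (units T) xs \<Longrightarrow> val xs \<in> units T"
  by (rule val_in) (auto intro: units_mul)

definition vals :: "'s \<Rightarrow> ('w list \<times> 's) list \<Rightarrow> 's set" where
  "vals p xs = {p \<cdot> val ys | ys zs. xs = ys @ zs \<and> ys \<noteq> []}"

lemma vals_prefix: "vals p xs \<subseteq> vals p (xs @ ys)"
proof
  fix v assume "v \<in> vals p xs"
  then obtain us zs where "xs = us @ zs" "us \<noteq> []" "v = p \<cdot> val us" by (auto simp: vals_def)
  then show "v \<in> vals p (xs @ ys)"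
    unfolding vals_def by (intro CollectI exI[of _ us] exI[of _ "zs @ ys"]) simp
qed

lemma vals_suffix: "xs \<noteq> [] \<Longrightarrow> vals (p \<cdot> val xs) ys \<subseteq> vals p (xs @ ys)"
proof
  fix v assume xs: "xs \<noteq> []" and "v \<in> vals (p \<cdot> val xs) ys"
  then obtain us zs where "ys = us @ zs" "us \<noteq> []" "v = p \<cdot> val xs \<cdot> val us" by (auto simp: vals_def)
  then show "v \<in> vals p (xs @ ys)"
    unfolding vals_def using xs
    by (intro CollectI exI[of _ "xs @ us"] exI[of _ zs]) (simp add: val_append assoc)
qed

lemma vals_first: "p \<cdot> snd x \<in> vals p (x # xs)"
  unfolding vals_def by (intro CollectI exI[of _ "[x]"] exI[of _ xs]) simp

lemma vals_snoc: "vals p (xs @ [x]) = insert (p \<cdot> val (xs @ [x])) (vals p xs)"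
proof -
  have "v = p \<cdot> val (xs @ [x]) \<or> v \<in> vals p xs" if v: "v \<in> vals p (xs @ [x])" for v
  proof -
    obtain ys zs where "xs @ [x] = ys @ zs" "ys \<noteq> []" "v = p \<cdot> val ys"
      using v by (auto simp: vals_def)
    then show ?thesis by (cases zs rule: rev_cases) (auto simp: vals_def)
  qed
  moreover have "p \<cdot> val (xs @ [x]) \<in> vals p (xs @ [x])"
    unfolding vals_def by (intro CollectI exI[of _ "xs @ [x]"] exI[of _ "[]"]) simp
  ultimately show ?thesis using vals_prefix[of p xs "[x]"] by (intro equalityI subsetI) auto
qed

text \<open>Inner prefix values that stay in \<open>V\<close> and avoid \<open>q\<close> let the
  induction in \<open>rep_stable_units\<close> drop \<open>q\<close> from its set of values.\<close>

definition first_return :: "'s \<Rightarrow> 's set \<Rightarrow> ('w list \<times> 's) list \<Rightarrow> bool" where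
  "first_return q V b \<longleftrightarrow>
    (\<exists>b' x. b = b' @ [x] \<and> q \<cdot> val b = q \<and> q \<notin> vals q b' \<and> vals q b' \<subseteq> V)"

lemma first_return_mono: "first_return q V b \<Longrightarrow> V \<subseteq> W \<Longrightarrow> first_return q W b"
  unfolding first_return_def by (elim exE conjE) (intro exI conjI; blast)

lemma val_returns:
  assumes "bs \<noteq> []" "\<forall>b\<in>set bs. b \<noteq> [] \<and> q \<cdot> val b = q"
  shows "q \<cdot> val (concat bs) = q \<and> concat bs \<noteq> []"
  using assms
proof (induction bs)
  case (Cons b bs)
  show ?case
  proof (cases "bs = []")
    case False
    then have "q \<cdot> val (concat bs) = q" "concat bs \<noteq> []" using Cons by simp_all
    then show ?thesis using Cons.prems by (simp add: val_append flip: assoc)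
  qed (use Cons.prems in simp)
qed simp

lemma split_at_returns:
  "\<exists>bs ys. xs = concat bs @ ys \<and> q \<notin> vals q ys \<and> vals q ys \<subseteq> vals q xs \<and>
    (\<forall>b\<in>set bs. first_return q (vals q xs) b)"
proof (induction xs rule: rev_induct)
  case Nil
  show ?case by (intro exI[of _ "[]"]) (simp add: vals_def)
next
  case (snoc x xs)
  then obtain bs ys where *: "xs = concat bs @ ys" "q \<notin> vals q ys" "vals q ys \<subseteq> vals q xs"
    "\<forall>b\<in>set bs. first_return q (vals q xs) b"
    by blast
  have mono: "vals q xs \<subseteq> vals q (xs @ [x])" by (rule vals_prefix)
  have bs: "\<forall>b\<in>set bs. first_return q (vals q (xs @ [x])) b"
    using *(4) first_return_mono[OF _ mono] by blast
  show ?case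
  proof (cases "q \<cdot> val (ys @ [x]) = q")
    case True
    then have "first_return q (vals q (xs @ [x])) (ys @ [x])"
      unfolding first_return_def using *(2,3) mono by blast
    then have "\<forall>b\<in>set (bs @ [ys @ [x]]). first_return q (vals q (xs @ [x])) b" using bs by simp
    moreover have "vals q [] = {}" by (simp add: vals_def)
    moreover have "xs @ [x] = concat (bs @ [ys @ [x]]) @ []" using *(1) by simp
    ultimately show ?thesis by blast
  next
    case False
    \<comment> \<open>The complete blocks all fix \<open>q\<close>, so reading everything from
      \<open>q\<close> ends where reading only the unfinished part \<open>ys\<close> ends.\<close>
    have eq: "q \<cdot> val (xs @ [x]) = q \<cdot> val (ys @ [x])"
    proof (cases "bs = []")
      case ne: False
      have "\<forall>b\<in>set bs. b \<noteq> [] \<and> q \<cdot> val b = q" using bs by (auto simp: first_return_def)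
      from val_returns[OF ne this] have "q \<cdot> val (concat bs) = q" "concat bs \<noteq> []" by simp_all
      moreover have "val (xs @ [x]) = val (concat bs) \<cdot> val (ys @ [x])"
        using *(1) val_append[OF \<open>concat bs \<noteq> []\<close>, of "ys @ [x]"] by simp
      ultimately show ?thesis by (simp flip: assoc)
    qed (use *(1) in simp)
    have "vals q (ys @ [x]) \<subseteq> vals q (xs @ [x])" "q \<notin> vals q (ys @ [x])"
      using *(2,3) False mono eq unfolding vals_snoc by auto
    moreover have "xs @ [x] = concat bs @ (ys @ [x])" using *(1) by simp
    ultimately show ?thesis using bs by blast
  qed
qed

text \<open>Induction on the set \<open>Y\<close> of admissible prefix values. After the first item
  the value is \<open>q\<close>, and the rest is cut at the returns to \<open>q\<close>. Strictly
  inside a piece \<open>q\<close> does not occur, so \<open>Y - {q}\<close> suffices there. By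
  cancellation all pieces have the same idempotent value, so one iteration joins them, and
  \<open>stable\<close> keeps the value exact. The four levels per element of \<open>Y\<close> pay
  for the last item of a piece, the iteration, the part after the last return, and the first
  item.\<close>

lemma rep_stable_units:
  assumes stable: "\<And>e. e \<in> units T \<Longrightarrow> e \<cdot> e = e \<Longrightarrow> sharp e = e"
  shows "finite Y \<Longrightarrow> p \<in> units T \<Longrightarrow> xs \<noteq> [] \<Longrightarrow> items h (units T) xs \<Longrightarrow> vals p xs \<subseteq> Y \<Longrightarrow>
    rep (h + 4 * card Y) (cw xs) (val xs)"
proof (induction "card Y" arbitrary: Y p xs)
  case 0
  then obtain x xs' where "xs = x # xs'" by (cases xs) auto
  then have "Y \<noteq> {}" using vals_first[of p x xs'] 0 by blast
  then show ?case using 0 by simp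
next
  case (Suc n)
  obtain x rest where xs: "xs = x # rest" using \<open>xs \<noteq> []\<close> by (cases xs) auto
  define q where "q = p \<cdot> snd x"
  have x: "snd x \<in> units T" "rep h (fst x) (snd x)" and rest: "items h (units T) rest"
    using Suc.prems(4) xs by simp_all
  have q: "q \<in> units T" unfolding q_def by (rule units_mul[OF Suc.prems(2) x(1)])
  have vr: "vals q rest \<subseteq> Y" using vals_suffix[of "[x]" p rest] Suc.prems(5) xs q_def by simp
  have qY: "q \<in> Y" using Suc.prems(5) vals_first[of p x rest] unfolding q_def xs by blast
  have n: "n = card (Y - {q})" using Suc.hyps(2) qY Suc.prems(1) by simp
  have IH: "rep (h + 4 * n) (cw ys) (val ys)"
    if "ys \<noteq> []" "items h (units T) ys" "q \<notin> vals q ys" "vals q ys \<subseteq> vals q rest" for ys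
    using Suc.hyps(1)[OF n _ q that(1,2), folded n] Suc.prems(1) that(3,4) vr by blast
  obtain bs ys where ys: "rest = concat bs @ ys" "q \<notin> vals q ys" "vals q ys \<subseteq> vals q rest"
    and ret: "\<forall>b\<in>set bs. first_return q (vals q rest) b"
    using split_at_returns[of rest q] by (elim exE conjE)
  have bs_items: "items h (units T) b" if "b \<in> set bs" for b
    using rest that unfolding ys(1) items_def by auto
  have bs_ne: "b \<noteq> []" "q \<cdot> val b = q" if "b \<in> set bs" for b
    using ret that by (auto simp: first_return_def)
  have bs_T: "val b \<in> units T" if "b \<in> set bs" for b
    by (rule val_units[OF bs_ne(1) bs_items]) (rule that)+
  have bs_rep: "rep (Suc (h + 4 * n)) (cw b) (val b)" if b: "b \<in> set bs" for b
  proof -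
    obtain b' z where z: "b = b' @ [z]" "q \<notin> vals q b'" "vals q b' \<subseteq> vals q rest"
      using ret b by (auto simp: first_return_def)
    have 1: "rep h (fst z) (snd z)" "items h (units T) b'" using bs_items[OF b] z(1) by auto
    have 2: "rep (h + 4 * n) (fst z) (snd z)" by (rule rep_mono[OF 1(1)]) simp
    show ?thesis
    proof (cases "b' = []")
      case True
      then show ?thesis using rep_Suc[OF 2] z(1) by simp
    next
      case False
      then show ?thesis using rep_mul[OF IH[OF False 1(2) z(2,3)] 2] z(1) by (simp add: val_append)
    qed
  qed
  have same: "val b = val c" if "b \<in> set bs" "c \<in> set bs" for b c
    by (rule units_cancel[OF q]) (use bs_ne bs_T units_T that in simp_all)
  have mid: "rep (h + 4 * n + 2) (cw (concat bs)) (val (concat bs)) \<and> concat bs \<noteq> []" if ne: "bs \<noteq> []"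
  proof -
    define f where "f = val (hd bs)"
    have hd: "hd bs \<in> set bs" using ne by simp
    have f: "f \<in> units T" using bs_T[OF hd] f_def by simp
    have ff: "f \<cdot> f = f" using unit_return[OF q units_T[OF f]] bs_ne(2)[OF hd] f_def by simp
    have all: "val b = f" if "b \<in> set bs" for b using same[OF that hd] f_def by simp
    have "rep (Suc (Suc (h + 4 * n))) (concat (map cw bs)) (sharp f)"
    proof (rule rep_sharp[OF _ _ ff T_S[OF units_T[OF f]]])
      show "\<forall>u\<in>set (map cw bs). rep (Suc (h + 4 * n)) u f" using bs_rep all by auto
    qed (use ne in simp)
    moreover have "val (concat bs) = f \<and> concat bs \<noteq> []"
      using ne all bs_ne(1)
    proof (induction bs)
      case (Cons b bs)
      then show ?case by (cases "bs = []") (simp_all add: val_append ff)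
    qed simp
    moreover have "cw (concat bs) = concat (map cw bs)" by (induction bs) auto
    ultimately show ?thesis using stable[OF f ff] by simp
  qed
  have rest_rep: "rep (h + 4 * n + 3) (cw rest) (val rest)" if ne: "rest \<noteq> []"
  proof -
    have y: "rep (h + 4 * n + 2) (cw ys) (val ys)" if "ys \<noteq> []"
      by (rule rep_mono[OF IH[OF that _ ys(2,3)]]) (use rest ys(1) in simp_all)
    consider "bs = []" "ys \<noteq> []" | "bs \<noteq> []" "ys = []" | "bs \<noteq> []" "ys \<noteq> []"
      using ne ys(1) by (cases "bs = []"; cases "ys = []") auto
    then show ?thesis
    proof cases
      case 1
      show ?thesis by (rule rep_mono[of "h + 4 * n + 2"]) (use y 1 ys(1) in simp_all)
    next
      case 2
      show ?thesis by (rule rep_mono[of "h + 4 * n + 2"]) (use mid 2 ys(1) in simp_all)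
    next
      case 3
      have "rep (h + 4 * n + 3) (cw (concat bs) @ cw ys) (val (concat bs) \<cdot> val ys)"
        by (rule rep_mul'[of "h + 4 * n + 2"]) (use mid y 3 in simp_all)
      then show ?thesis using ys(1) val_append[of "concat bs" ys] mid 3 by simp
    qed
  qed
  have x': "rep (h + 4 * n + 3) (fst x) (snd x)" by (rule rep_mono[OF x(2)]) simp
  have card: "h + 4 * n + 3 < h + 4 * card Y" using Suc.hyps(2) by simp
  show ?case
  proof (cases "rest = []")
    case True
    then show ?thesis using rep_mono[OF x'] card xs by simp
  next
    case False
    then show ?thesis using rep_mul'[OF x' rest_rep card] xs by (simp add: val_Cons)
  qed
qed

text \<open>Two of the \<open>card T + 1\<close> nonempty prefixes have the same value. The factor
  between them fixes this unit and is idempotent by \<open>unit_return\<close>.\<close>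

lemma idempotent_factor:
  assumes xs: "items h (units T) xs" "length xs = Suc (card T)"
  shows "\<exists>x y z. xs = x @ y @ z \<and> y \<noteq> [] \<and> val y \<cdot> val y = val y"
proof -
  have "(\<lambda>i. val (take (Suc i) xs)) ` {..<Suc (card T)} \<subseteq> T"
  proof safe
    fix i assume "i < Suc (card T)"
    have "items h (units T) (take (Suc i) xs)"
      using xs(1) items_append[of h "units T" "take (Suc i) xs" "drop (Suc i) xs"] by (simp del: items_append)
    then show "val (take (Suc i) xs) \<in> T"
      using val_units[of "take (Suc i) xs" h] xs(2) units_T by fastforce
  qed
  then have "\<not> inj_on (\<lambda>i. val (take (Suc i) xs)) {..<Suc (card T)}"
    using card_inj_on_le[of _ "{..<Suc (card T)}" T] T by (auto simp: closed_def)
  then obtain i j where "i < j" "j < Suc (card T)" "val (take (Suc i) xs) = val (take (Suc j) xs)"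
    unfolding inj_on_def by (metis lessThan_iff linorder_neqE_nat)
  moreover define x y z where "x = take (Suc i) xs" "y = drop (Suc i) (take (Suc j) xs)" "z = drop (Suc j) xs"
  moreover have xy: "x @ y = take (Suc j) xs" using calculation
    by (metis Suc_mono append_take_drop_id less_imp_le_nat min.absorb1 take_take)
  ultimately have y: "y \<noteq> []" "x \<noteq> []" "val (x @ y) = val x" "xs = x @ y @ z"
    using xs(2) by (auto simp flip: append_assoc)
  have "items h (units T) x" "items h (units T) y" using xs(1) y(4) by auto
  then have "val y \<cdot> val y = val y"
    using unit_return[of "val x" "val y"] y val_units units_T by (auto simp: val_append)
  then show ?thesis using y by blast
qed

text \<open>Every window of \<open>card T + 1\<close> items contains a factor with an idempotent
  value, and stabilizing it leads into the right ideal of \<open>sharp e\<close>. The short stretch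
  up to the next such factor is multiplied on the right, which stays in the ideal; only the stretch
  \<open>x\<close> before the first factor is left over.\<close>

lemma split_at_idempotents:
  assumes e: "e \<in> units T" "e \<cdot> e = e"
    and "items h (units T) xs"
  shows "\<exists>x bs. cw xs = cw x @ cw bs \<and> (xs \<noteq> [] \<longrightarrow> x \<noteq> [] \<or> bs \<noteq> []) \<and> items h (units T) x \<and> length x \<le> Suc (card T) \<and>
    items (h + card T + 3) ((\<lambda>t. sharp e \<cdot> t) ` T) bs"
  using assms(3)
proof (induction "length xs" arbitrary: xs rule: less_induct)
  case less
  show ?case
  proof (cases "length xs \<le> Suc (card T)")
    case True
    then show ?thesis using less.prems by (intro exI[of _ xs] exI[of _ "[]"]) auto
  next
    case False
    define us where "us = take (Suc (card T)) xs"
    have us: "items h (units T) us" "length us = Suc (card T)" "xs = us @ drop (Suc (card T)) xs"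
      using less.prems items_append[of h "units T" us "drop (Suc (card T)) xs"] False by (auto simp: us_def)
    from idempotent_factor[OF us(1,2)] obtain x y z where xyz: "us = x @ y @ z" "y \<noteq> []" "val y \<cdot> val y = val y"
      by blast
    define r where "r = z @ drop (Suc (card T)) xs"
    have xs: "xs = x @ y @ r" using us(3) xyz(1) r_def by simp
    have it: "items h (units T) x" "items h (units T) y" "items h (units T) r" using less.prems xs by auto
    have "length r < length xs" using xs xyz(2) by simp
    from less.hyps[OF this it(3)] obtain x' bs where IH: "cw r = cw x' @ cw bs" "items h (units T) x'"
      "length x' \<le> Suc (card T)" "items (h + card T + 3) ((\<lambda>t. sharp e \<cdot> t) ` T) bs" by auto
    define f where "f = val y"
    have f: "f \<in> units T" "f \<cdot> f = f" using val_units[OF xyz(2) it(2)] xyz(3) f_def by auto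
    \<comment> \<open>Idempotent units are left identities on \<open>T\<close>, so \<open>e\<close>
      and \<open>f\<close> satisfy the hypotheses of \<open>sharp_swap\<close>.\<close>
    have sf: "sharp f = sharp e \<cdot> f"
      using sharp_swap[of e f] e f unit_idem_left[of e f] unit_idem_left[of f e] units_T T_S by auto
    have "rep (h + length y) (cw y) f" using rep_list[OF it(2) xyz(2)] f_def by simp
    then have "rep (h + Suc (card T)) (cw y) f" using us(2) xyz(1) rep_mono by auto
    \<comment> \<open>An iteration with a single factor already turns the label \<open>f\<close>
      into \<open>sharp f\<close>.\<close>
    then have "rep (Suc (h + Suc (card T))) (concat [cw y]) (sharp f)"
      by (intro rep_sharp) (use f units_T T_S in auto)
    then have y: "rep (h + card T + 2) (cw y) (sharp f)" by simp
    define c where "c = (if x' = [] then sharp f else sharp f \<cdot> val x')"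
    have "rep (h + card T + 3) (cw y @ cw x') c"
    proof (cases "x' = []")
      case True
      then show ?thesis using y rep_Suc[OF y] by (simp add: c_def eval_nat_numeral)
    next
      case False
      have "rep (h + card T + 2) (cw x') (val x')"
        using rep_mono[OF rep_list[OF IH(2) False]] IH(3) by simp
      then show ?thesis using False rep_mul'[OF y] by (simp add: c_def)
    qed
    moreover have "c \<in> (\<lambda>t. sharp e \<cdot> t) ` T"
      using sf f(1) units_T mul_T val_units[OF _ IH(2)] by (auto simp: c_def assoc)
    ultimately show ?thesis
      using IH it(1) xs xyz us(2)
      by (intro exI[of _ x] exI[of _ "(cw y @ cw x', c) # bs"]) auto
  qed
qed

text \<open>If \<open>sharp e\<close> were a unit, it would be idempotent and hence a left identity,
  so \<open>sharp e \<cdot> e = e\<close>; but by \<open>sharp_right\<close> this product is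
  \<open>sharp e\<close>.\<close>

lemma sharp_proper:
  assumes e: "e \<in> units T" "e \<cdot> e = e" "sharp e \<noteq> e"
  shows "sharp e \<in> T" "(\<lambda>t. sharp e \<cdot> t) ` T \<noteq> T"
proof -
  have eT: "e \<in> T" "e \<in> S" using e units_T T_S by auto
  then show s: "sharp e \<in> T" using T e(2) by (auto simp: closed_def)
  show "(\<lambda>t. sharp e \<cdot> t) ` T \<noteq> T"
  proof
    assume "(\<lambda>t. sharp e \<cdot> t) ` T = T"
    then have "sharp e \<in> units T" using s by (simp add: units_def)
    then have "sharp e \<cdot> e = e" using unit_idem_left sharp_idem e eT by blast
    then show False using sharp_right e eT by auto
  qed
qed

text \<open>If \<open>sharp\<close> fixes every idempotent unit, the exact values can be kept.
  Otherwise an idempotent that it moves yields a proper right ideal, and one application of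
  \<open>ideal\<close> finishes.\<close>

lemma covered_units:
  assumes ideal: "\<And>a h. a \<in> T \<Longrightarrow> (\<lambda>t. a \<cdot> t) ` T \<noteq> T \<Longrightarrow>
    covered ((\<lambda>t. a \<cdot> t) ` T) h ((\<lambda>t. a \<cdot> t) ` T) (h + d)"
  shows "covered (units T) h T (h + d + 4 * card T + 10)"
  unfolding covered_def
proof (intro allI impI)
  fix xs assume xs: "xs \<noteq> []" "items h (units T) xs"
  show "\<exists>c\<in>T. rep (h + d + 4 * card T + 10) (cw xs) c"
  proof (cases "\<forall>e\<in>units T. e \<cdot> e = e \<longrightarrow> sharp e = e")
    case True
    have "vals (snd (hd xs)) xs \<subseteq> T"
    proof
      fix v assume "v \<in> vals (snd (hd xs)) xs"
      then obtain ys zs where "xs = ys @ zs" "ys \<noteq> []" "v = snd (hd xs) \<cdot> val ys" by (auto simp: vals_def)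
      moreover have "snd (hd xs) \<in> T" using xs units_T by (cases xs) auto
      ultimately show "v \<in> T" using mul_T units_T[OF val_units[of ys h]] xs(2) by simp
    qed
    moreover have "snd (hd xs) \<in> units T" using xs by (cases xs) auto
    ultimately have "rep (h + 4 * card T) (cw xs) (val xs)"
      using rep_stable_units[of T "snd (hd xs)" xs h] True xs T unfolding closed_def by blast
    then have "rep (h + d + 4 * card T + 10) (cw xs) (val xs)" by (rule rep_mono) simp
    then show ?thesis using units_T[OF val_units[OF xs]] by blast
  next
    case False
    then obtain e where e: "e \<in> units T" "e \<cdot> e = e" "sharp e \<noteq> e" by blast
    obtain x bs where *: "cw xs = cw x @ cw bs"
      "xs \<noteq> [] \<longrightarrow> x \<noteq> [] \<or> bs \<noteq> []" "items h (units T) x" "length x \<le> Suc (card T)"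
      "items (h + card T + 3) ((\<lambda>t. sharp e \<cdot> t) ` T) bs"
      using split_at_idempotents[OF e(1,2) xs(2)] by (elim exE conjE)
    let ?h = "h + card T + 3 + d"
    have x: "rep ?h (cw x) (val x) \<and> val x \<in> T" if "x \<noteq> []"
      using rep_mono[OF rep_list[OF *(3) that]] *(4) units_T[OF val_units[OF that *(3)]] by simp
    have b: "\<exists>c\<in>T. rep ?h (cw bs) c" if ne: "bs \<noteq> []"
    proof -
      obtain c where "c \<in> (\<lambda>t. sharp e \<cdot> t) ` T" "rep ?h (cw bs) c"
        using ideal[OF sharp_proper[OF e], of "h + card T + 3"] *(5) ne unfolding covered_def by blast
      then show ?thesis using mul_T[OF sharp_proper(1)[OF e]] by blast
    qed
    have "\<exists>c\<in>T. rep (Suc ?h) (cw xs) c"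
    proof (cases "bs = []")
      case True
      then show ?thesis using x *(1,2) xs(1) rep_Suc[of ?h "cw x" "val x"] by auto
    next
      case False
      then obtain c where c: "c \<in> T" "rep ?h (cw bs) c" using b by blast
      show ?thesis
      proof (cases "x = []")
        case True
        then show ?thesis using c *(1) rep_Suc[OF c(2)] by auto
      next
        case False
        then have "rep (Suc ?h) (cw xs) (val x \<cdot> c)" "val x \<cdot> c \<in> T"
          using x c rep_mul[OF _ c(2)] mul_T *(1) by simp_all
        then show ?thesis by blast
      qed
    qed
    then obtain c where c: "c \<in> T" "rep (Suc ?h) (cw xs) c" by blast
    have "rep (h + d + 4 * card T + 10) (cw xs) c" by (rule rep_mono[OF c(2)]) simp
    then show ?thesis using c(1) by blast
  qed
qed

end

lemma covered_empty: "covered {} h T h'"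
  unfolding covered_def
proof (intro allI impI)
  fix xs :: "('w list \<times> 's) list"
  assume "xs \<noteq> []" "items h {} xs"
  then show "\<exists>c\<in>T. rep h' (cw xs) c" by (cases xs) simp_all
qed

lemma covered_mono: "covered X h T h' \<Longrightarrow> Y \<subseteq> X \<Longrightarrow> h' \<le> h'' \<Longrightarrow> covered Y h T h''"
  unfolding covered_def
proof (intro allI impI)
  fix xs
  assume c: "\<forall>xs. xs \<noteq> [] \<longrightarrow> items h X xs \<longrightarrow> (\<exists>c\<in>T. rep h' (cw xs) c)"
    and Y: "Y \<subseteq> X" "h' \<le> h''" and xs: "xs \<noteq> []" "items h Y xs"
  have "items h X xs" by (rule items_mono[OF xs(2) Y(1)]) simp
  then obtain d where d: "d \<in> T" "rep h' (cw xs) d" using c xs(1) by blast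
  show "\<exists>c\<in>T. rep h'' (cw xs) c" using d(1) rep_mono[OF d(2) Y(2)] by blast
qed

text \<open>The outer induction on the size of \<open>T\<close> pays for passing to proper right
  ideals, the inner one on the set \<open>X\<close> of letters for removing non-units. Items of
  arbitrary height \<open>h\<close> are allowed because the blocks of one stage are the letters of
  the next.\<close>

theorem bounded_factorization:
  assumes "closed T" "card T \<le> s"
  shows "covered T h T (h + height_bound s)"
  using assms
proof (induction s arbitrary: T h)
  case 0
  then have "T = {}" by (simp add: closed_def)
  then show ?case by (simp add: covered_empty)
next
  case (Suc s)
  note T = Suc.prems(1)
  have fin: "finite T" and mul: "\<And>x y. x \<in> T \<Longrightarrow> y \<in> T \<Longrightarrow> x \<cdot> y \<in> T" using T by (simp_all add: closed_def)
  define D where "D = height_bound s + 4 * Suc s + 10"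
  have ideal: "covered ((\<lambda>t. a \<cdot> t) ` T) h ((\<lambda>t. a \<cdot> t) ` T) (h + height_bound s)"
    if a: "a \<in> T" "(\<lambda>t. a \<cdot> t) ` T \<noteq> T" for a h
  proof (rule Suc.IH[OF closed_left_ideal[OF T a(1)]])
    have "(\<lambda>t. a \<cdot> t) ` T \<subset> T" using a mul by blast
    then show "card ((\<lambda>t. a \<cdot> t) ` T) \<le> s"
      using psubset_card_mono[OF fin, of "(\<lambda>t. a \<cdot> t) ` T"] Suc.prems(2) by linarith
  qed
  have cT: "card T \<le> Suc s" by (rule Suc.prems(2))
  have "covered X h T (h + n * D)" if "X \<subseteq> T" "card X \<le> n" for X n h
    using that
  proof (induction n arbitrary: X)
    case 0
    then have "X = {}" using finite_subset[OF _ fin, of X] by simp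
    then show ?case by (simp add: covered_empty)
  next
    case (Suc n)
    show ?case
    proof (cases "X \<subseteq> units T")
      case True
      have le: "h + height_bound s + 4 * card T + 10 \<le> h + Suc n * D" using cT by (simp add: D_def)
      show ?thesis by (rule covered_mono[OF covered_units[OF T ideal] True le])
    next
      case False
      then obtain a where a: "a \<in> X" "(\<lambda>t. a \<cdot> t) ` T \<noteq> T" using Suc.prems(1) by (auto simp: units_def)
      have "card (X - {a}) \<le> n" using a(1) Suc.prems(2) by (simp add: card_Diff_singleton_if)
      then have 1: "covered (X - {a}) h T (h + n * D)" using Suc.IH[of "X - {a}"] Suc.prems(1) by blast
      \<comment> \<open>Two levels build blocks and pairs, two glue the leftovers; they fit into the
        summand 10 of \<open>D\<close>.\<close>
      have "covered X h T (Suc (Suc (Suc (Suc (h + n * D)) + height_bound s)))"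
        by (rule covered_shrinking_letter[OF T a(1) Suc.prems(1) 1 _ ideal]) (use a(2) subsetD[OF Suc.prems(1) a(1)] in simp_all)
      moreover have "Suc (Suc (Suc (Suc (h + n * D)) + height_bound s)) \<le> h + Suc n * D" by (simp add: D_def)
      ultimately show ?thesis by (rule covered_mono[OF _ subset_refl])
    qed
  qed
  from this[of T "Suc s" h] show ?case using Suc.prems(2) by (simp add: D_def)
qed

end

section \<open>Distance automata\<close>

lemma path_append: "path T p (v @ w) q \<longleftrightarrow> (\<exists>r. path T p v r \<and> path T r w q)"
proof (induction v arbitrary: p)
  case Nil
  then show ?case by (auto intro: path_Nil elim: path.cases)
next
  case (Cons c v)
  have *: "path T p (c # u) s \<longleftrightarrow> (\<exists>t. (p, c, t) \<in> set T \<and> path T t u s)" for u s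
    by (auto intro: path_Cons elim: path.cases)
  show ?case using Cons by (auto simp: *)
qed

lemma path_Cons_iff: "path T p (c # w) q \<longleftrightarrow> (\<exists>r. (p, c, r) \<in> set T \<and> path T r w q)"
  by (auto intro: path_Cons elim: path.cases)

lemma path_Nil_iff [simp]: "path T p [] q \<longleftrightarrow> p = q"
  by (auto intro: path_Nil elim: path.cases)

lemma pi_in_append [simp]: "pi_in (v @ w) = pi_in v @ pi_in w"
  by (induction v rule: pi_in.induct) auto

lemma pi_out_append [simp]: "pi_out (v @ w) = pi_out v @ pi_out w"
  by (induction v rule: pi_out.induct) auto

lemma pi_in_eq_Cons:
  "pi_in w = a # u \<Longrightarrow> \<exists>w1 w2. w = w1 @ Inl a # w2 \<and> pi_in w1 = [] \<and> pi_in w2 = u"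
proof (induction w rule: pi_in.induct)
  case (2 b w)
  then show ?case by (intro exI[of _ "[]"] exI[of _ w]) auto
next
  case (3 b w)
  then obtain w1 w2 where "w = w1 @ Inl a # w2" "pi_in w1 = []" "pi_in w2 = u" by auto
  then show ?case by (intro exI[of _ "Inr b # w1"] exI[of _ w2]) auto
qed simp

lemma pi_in_eq_append:
  "pi_in w = u @ v \<Longrightarrow> \<exists>w1 w2. w = w1 @ w2 \<and> pi_in w1 = u \<and> pi_in w2 = v"
proof (induction u arbitrary: w)
  case Nil
  then show ?case by (intro exI[of _ "[]"] exI[of _ w]) auto
next
  case (Cons a u)
  then obtain w1 w2 where w: "w = w1 @ Inl a # w2" "pi_in w1 = []" "pi_in w2 = u @ v"
    using pi_in_eq_Cons[of w a "u @ v"] by auto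
  with Cons.IH obtain w3 w4 where "w2 = w3 @ w4" "pi_in w3 = u" "pi_in w4 = v" by blast
  then show ?case using w by (intro exI[of _ "w1 @ Inl a # w3"] exI[of _ w4]) auto
qed

lemma relcomp_absorb: "x O y = z \<Longrightarrow> x O (y O w) = z O w"
  by (simp flip: O_assoc)

lemma relcomp_subset_absorb: "z \<subseteq> b \<Longrightarrow> b O x = y \<Longrightarrow> z O x \<subseteq> y"
  using relcomp_mono[of z b x x] by simp

type_synonym label = "nat rel \<times> nat rel \<times> nat rel"

text \<open>A label \<open>(z, b, r)\<close> abstracts the cost matrix of a word to the values 0 (in z), bounded (in b),
  unbounded (in r), infinite (not in r). A loop of an idempotent label keeps its cost bounded
  only if it spends all but boundedly many iterations in z.\<close>
fun label_mul :: "label \<Rightarrow> label \<Rightarrow> label" where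
  "label_mul (z, b, r) (z', b', r') = (z O z', b O b', r O r')"

fun label_sharp :: "label \<Rightarrow> label" where
  "label_sharp (z, b, r) = (z, b O z O b, r)"

definition labels :: "label set" where
  "labels = {(z, b, r). z \<subseteq> b}"

locale distance_automaton =
  fixes T :: "(nat \<times> (nat + nat) \<times> nat) list" and n :: nat
  assumes states: "(p, c, q) \<in> set T \<Longrightarrow> p < n \<and> q < n"
begin

section \<open>Costs of runs on a given input\<close>

definition dist :: "nat \<Rightarrow> nat list \<Rightarrow> nat rel" where
  "dist j u = {(p, q). p < n \<and> (\<exists>w. path T p w q \<and> pi_in w = u \<and> length (pi_out w) \<le> j)}"

definition reach :: "nat list \<Rightarrow> nat rel" where
  "reach u = (\<Union>j. dist j u)"

lemma path_state: "path T p w q \<Longrightarrow> p < n \<Longrightarrow> q < n"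
  by (induction w arbitrary: p) (auto simp: path_Cons_iff dest: states)

lemma dist_mono: "i \<le> j \<Longrightarrow> dist i u \<subseteq> dist j u"
  unfolding dist_def by auto

lemma dist_comp: "dist i u O dist j v \<subseteq> dist (i + j) (u @ v)"
proof
  fix x assume "x \<in> dist i u O dist j v"
  then obtain p r q w w' where x: "x = (p, q)" "p < n" and w: "path T p w r" "path T r w' q"
    "pi_in w = u" "pi_in w' = v" "length (pi_out w) \<le> i" "length (pi_out w') \<le> j"
    by (auto simp: dist_def)
  then have "path T p (w @ w') q" by (auto simp: path_append)
  then show "x \<in> dist (i + j) (u @ v)" using x w unfolding dist_def
    by (auto intro!: exI[of _ "w @ w'"])
qed

text \<open>The exact split of the budget matters in \<open>realized_sharp\<close>, where a block
  that is not free must leave less for the remaining ones.\<close>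

lemma dist_append:
  assumes "(p, q) \<in> dist j (u @ v)"
  shows "\<exists>i r. i \<le> j \<and> (p, r) \<in> dist i u \<and> (r, q) \<in> dist (j - i) v"
proof -
  obtain w where w: "p < n" "path T p w q" "pi_in w = u @ v" "length (pi_out w) \<le> j"
    using assms by (auto simp: dist_def)
  from pi_in_eq_append[OF w(3)] obtain w1 w2 where ww: "w = w1 @ w2" "pi_in w1 = u" "pi_in w2 = v" by blast
  obtain r where r: "path T p w1 r" "path T r w2 q" using w(2) ww(1) by (auto simp: path_append)
  have "(p, r) \<in> dist (length (pi_out w1)) u" using w(1) r ww unfolding dist_def by auto
  moreover have "(r, q) \<in> dist (j - length (pi_out w1)) v"
    using path_state[OF r(1) w(1)] r ww w(4) unfolding dist_def by auto
  ultimately show ?thesis using w(4) ww(1) by (intro exI[of _ "length (pi_out w1)"] exI[of _ r]) auto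
qed

lemma dist_append_subset: "dist j (u @ v) \<subseteq> dist j u O dist j v"
proof
  fix x assume x: "x \<in> dist j (u @ v)"
  obtain p q where pq: "x = (p, q)" by (cases x)
  obtain i r where i: "i \<le> j" "(p, r) \<in> dist i u" "(r, q) \<in> dist (j - i) v"
    using dist_append x pq by blast
  have "(p, r) \<in> dist j u" "(r, q) \<in> dist j v"
    using i dist_mono[of i j u] dist_mono[of "j - i" j v] by auto
  then show "x \<in> dist j u O dist j v" using pq by blast
qed

lemma dist0_append: "dist 0 (u @ v) = dist 0 u O dist 0 v"
  using dist_append_subset[of 0 u v] dist_comp[of 0 u 0 v] by auto

lemma reach_append: "reach (u @ v) = reach u O reach v"
proof
  show "reach (u @ v) \<subseteq> reach u O reach v"
  proof
    fix x assume "x \<in> reach (u @ v)"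
    then obtain j where "x \<in> dist j (u @ v)" by (auto simp: reach_def)
    then have "x \<in> dist j u O dist j v" using dist_append_subset[of j u v] by (rule subsetD[rotated])
    then show "x \<in> reach u O reach v" by (auto simp: reach_def)
  qed
  show "reach u O reach v \<subseteq> reach (u @ v)"
  proof
    fix x assume "x \<in> reach u O reach v"
    then obtain i j where "x \<in> dist i u O dist j v" by (auto simp: reach_def)
    then have "x \<in> dist (i + j) (u @ v)" using dist_comp[of i u j v] by (rule subsetD[rotated])
    then show "x \<in> reach (u @ v)" by (auto simp: reach_def)
  qed
qed

lemma dist_states: "dist j u \<subseteq> {..<n} \<times> {..<n}"
  unfolding dist_def using path_state by auto

lemma reach_states: "reach u \<subseteq> {..<n} \<times> {..<n}"
  unfolding reach_def using dist_states by blast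

text \<open>Cycles without input letters can be cut.\<close>
lemma reach_Nil: "reach [] \<subseteq> dist (length T) []"
proof
  fix x assume "x \<in> reach []"
  then obtain p q w where x: "x = (p, q)" and w: "p < n" "path T p w q" "pi_in w = []"
    by (auto simp: reach_def dist_def)
  define E where "E = {(p, q). \<exists>b. (p, Inr b, q) \<in> set T}"
  have E: "E \<subseteq> (\<lambda>(p, c, q). (p, q)) ` set T" unfolding E_def by force
  then have fin: "finite E" by (rule finite_subset) simp
  have cE: "card E \<le> length T"
    using card_mono[OF _ E] card_image_le[of "set T" "\<lambda>(p, c, q). (p, q)"] card_length[of T] by simp
  have 1: "(p, q) \<in> E\<^sup>*" using w(2,3)
  proof (induction w arbitrary: p rule: pi_in.induct)
    case (3 b w)
    then obtain r where "(p, r) \<in> E" "(r, q) \<in> E\<^sup>*" by (auto simp: path_Cons_iff E_def)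
    then show ?case by (rule converse_rtrancl_into_rtrancl)
  qed simp_all
  have 2: "\<exists>w. path T p w q \<and> pi_in w = [] \<and> length (pi_out w) = j" if "(p, q) \<in> E ^^ j" for j q
    using that
  proof (induction j arbitrary: q)
    case 0
    then show ?case by (intro exI[of _ "[]"]) auto
  next
    case (Suc j)
    then obtain r b where r: "(p, r) \<in> E ^^ j" "(r, Inr b, q) \<in> set T" by (auto simp: E_def)
    obtain w where "path T p w r" "pi_in w = []" "length (pi_out w) = j" using Suc.IH[OF r(1)] by blast
    then show ?case using r(2)
      by (intro exI[of _ "w @ [Inr b]"]) (auto simp: path_append path_Cons_iff)
  qed
  obtain j where "j \<le> card E" "(p, q) \<in> E ^^ j" using 1 rtrancl_finite_eq_relpow[OF fin] by auto
  then show "x \<in> dist (length T) []" using 2 cE w(1) unfolding x dist_def by fastforce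
qed

text \<open>By \<open>reach_Nil\<close>, \<open>length T\<close> outputs suffice before the input
  letter and as many after it; reading the letter is free.\<close>

lemma reach_letter: "reach [a] \<subseteq> dist (2 * length T) [a]"
proof
  fix x assume "x \<in> reach [a]"
  then obtain p q w where x: "x = (p, q)" and w: "p < n" "path T p w q" "pi_in w = [a]"
    by (auto simp: reach_def dist_def)
  from pi_in_eq_Cons[OF w(3)] obtain w1 w2 where ww: "w = w1 @ Inl a # w2" "pi_in w1 = []" "pi_in w2 = []" by blast
  then obtain r s where r: "path T p w1 r" "(r, Inl a, s) \<in> set T" "path T s w2 q"
    using w(2) by (auto simp: path_append path_Cons_iff)
  have "(p, r) \<in> reach []" "(s, q) \<in> reach []"
    using w(1) r ww states[OF r(2)] unfolding reach_def dist_def by auto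
  then have pr: "(p, r) \<in> dist (length T) []" and sq: "(s, q) \<in> dist (length T) []"
    using reach_Nil by auto
  have "path T r [Inl a] s" using r(2) by (auto simp: path_Cons_iff)
  then have "(r, s) \<in> dist 0 [a]"
    using states[OF r(2)] unfolding dist_def by (auto intro!: exI[of _ "[Inl a]"])
  then have "(p, s) \<in> dist (length T + 0) ([] @ [a])" using pr dist_comp by blast
  then have "(p, q) \<in> dist (length T + 0 + length T) (([] @ [a]) @ [])" using sq dist_comp by blast
  then show "x \<in> dist (2 * length T) [a]" using x by (simp add: mult_2)
qed

text \<open>The entries of \<open>z\<close> and \<open>b\<close> are promises about runs on
  \<open>u\<close>, whereas \<open>r\<close> must contain everything reachable. The factor
  \<open>2 * length T\<close> covers single letters, and every level doubles it.\<close>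

fun label_rep :: "nat \<Rightarrow> nat list \<Rightarrow> label \<Rightarrow> bool" where
  "label_rep h u (z, b, r) \<longleftrightarrow> z \<subseteq> dist 0 u \<and> b \<subseteq> dist (2 * length T * 2 ^ h) u \<and> reach u \<subseteq> r"

sublocale stabilization label_mul labels label_sharp label_rep
proof
  show "label_mul (label_mul a b) c = label_mul a (label_mul b c)" for a b c
    by (cases a; cases b; cases c) (simp add: O_assoc)
next
  fix e assume e: "label_mul e e = e" "e \<in> labels"
  obtain z b r where zbr: "e = (z, b, r)" by (cases e)
  have id: "z O z = z" "b O b = b" "r O r = r" "z \<subseteq> b" using e zbr by (auto simp: labels_def)
  note id' = id(2)[THEN relcomp_absorb]
  show "label_mul e (label_sharp e) = label_sharp e" using zbr id id' by simp
  show "label_mul (label_sharp e) e = label_sharp e" using zbr id by (simp add: O_assoc)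
  \<comment> \<open>One inclusion enlarges a factor \<open>z O b\<close> to \<open>b\<close>. The
    other unfolds \<open>z\<close> to \<open>z O z O z\<close> and enlarges the middle copy to
    \<open>b\<close>.\<close>
  have "b O z O b O b O z O b = b O z O b"
  proof
    have "z O b \<subseteq> b" by (rule relcomp_subset_absorb[OF id(4,2)])
    then have "b O (z O b) O (b O z O b) \<subseteq> b O b O (b O z O b)" by (intro relcomp_mono) auto
    then show "b O z O b O b O z O b \<subseteq> b O z O b" by (simp add: O_assoc id')
    have "b O z O b = b O z O z O z O b" by (simp add: id(1)[THEN relcomp_absorb])
    also have "\<dots> \<subseteq> b O z O b O z O b" using id(4) by (intro relcomp_mono) auto
    finally show "b O z O b \<subseteq> b O z O b O b O z O b" by (simp add: id')
  qed
  then show "label_mul (label_sharp e) (label_sharp e) = label_sharp e"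
    using zbr id by (simp add: O_assoc)
next
  fix e f assume S: "e \<in> labels" "f \<in> labels" and i: "label_mul e e = e" "label_mul f f = f"
    "label_mul e f = f" "label_mul f e = e"
  obtain z b r where e: "e = (z, b, r)" by (cases e)
  obtain z' b' r' where f: "f = (z', b', r')" by (cases f)
  have sub: "z \<subseteq> b" "z' \<subseteq> b'" using S e f by (auto simp: labels_def)
  have eq: "z O z' = z'" "z' O z = z" "b O b' = b'" "b' O b = b" "r O r' = r'" "z' O z' = z'" "z O z = z"
    "b' O b' = b'" "b O b = b"
    using i e f by auto
  \<comment> \<open>From \<open>z = z O z\<close>, \<open>z \<subseteq> b\<close> and
    \<open>b' O b = b\<close> it follows that \<open>b'\<close> in front of \<open>z\<close> can be
    enlarged to \<open>b\<close>; symmetrically for \<open>b\<close> in front of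
    \<open>z'\<close>.\<close>
  have "b' O z' O b' = b O z O b O b'"
  proof
    have "b' O z \<subseteq> b O z"
    proof -
      have "b' O z O z \<subseteq> b' O b O z" using sub by (intro relcomp_mono) auto
      also have "\<dots> = b O z" by (simp add: O_assoc eq eq[THEN relcomp_absorb])
      finally show ?thesis by (simp add: eq)
    qed
    from relcomp_mono[OF order_refl relcomp_mono[OF this relcomp_subset_absorb[OF sub(2) eq(8)]]]
    have "b O (b' O z) O (z' O b') \<subseteq> b O (b O z) O b'" .
    moreover have "b O (b' O z) O (z' O b') = b' O z' O b'" by (simp add: O_assoc eq eq[THEN relcomp_absorb])
    moreover have "b O (b O z) O b' = b O z O b O b'" by (simp add: O_assoc eq eq[THEN relcomp_absorb])
    ultimately show "b' O z' O b' \<subseteq> b O z O b O b'" by simp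
    have "b O z' \<subseteq> b' O z'"
    proof -
      have "b O z' O z' \<subseteq> b O b' O z'" using sub by (intro relcomp_mono) auto
      also have "\<dots> = b' O z'" by (simp add: O_assoc eq eq[THEN relcomp_absorb])
      finally show ?thesis by (simp add: eq)
    qed
    from relcomp_mono[OF order_refl relcomp_mono[OF this relcomp_subset_absorb[OF sub(1) eq(3)]]]
    have "b' O (b O z') O (z O b') \<subseteq> b' O (b' O z') O b'" .
    moreover have "b' O (b O z') O (z O b') = b O z O b O b'" by (simp add: O_assoc eq eq[THEN relcomp_absorb])
    moreover have "b' O (b' O z') O b' = b' O z' O b'" by (simp add: O_assoc eq eq[THEN relcomp_absorb])
    ultimately show "b O z O b O b' \<subseteq> b' O z' O b'" by simp
  qed
  then show "label_sharp f = label_mul (label_sharp e) f" using e f eq by (simp add: O_assoc)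
next
  fix h u c assume "label_rep h u c"
  then show "label_rep (Suc h) u c"
    using dist_mono[of "2 * length T * 2 ^ h" "2 * length T * 2 ^ Suc h" u] by (cases c) auto
next
  fix h u c v d assume a: "label_rep h u c" "label_rep h v d"
  obtain z b r z' b' r' where [simp]: "c = (z, b, r)" "d = (z', b', r')" by (cases c; cases d)
  let ?K = "2 * length T * 2 ^ h"
  have "b O b' \<subseteq> dist ?K u O dist ?K v" using a by (intro relcomp_mono) auto
  also have "\<dots> \<subseteq> dist (?K + ?K) (u @ v)" by (rule dist_comp)
  also have "?K + ?K = 2 * length T * 2 ^ Suc h" by simp
  finally have "b O b' \<subseteq> dist (2 * length T * 2 ^ Suc h) (u @ v)" .
  moreover have "z O z' \<subseteq> dist 0 (u @ v)" "reach (u @ v) \<subseteq> r O r'"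
    using a relcomp_mono unfolding dist0_append reach_append by auto
  ultimately show "label_rep (Suc h) (u @ v) (label_mul c d)" by simp
next
  fix us :: "nat list list" and h e
  assume us: "us \<noteq> []" "\<forall>u\<in>set us. label_rep h u e" and e: "label_mul e e = e" "e \<in> labels"
  obtain z b r where [simp]: "e = (z, b, r)" by (cases e)
  have id: "z O z = z" "b O b = b" "r O r = r" "z \<subseteq> b" using e by (auto simp: labels_def)
  let ?K = "2 * length T * 2 ^ h"
  have z: "z \<subseteq> dist 0 (concat us)" if "us \<noteq> []" "\<forall>u\<in>set us. label_rep h u e" for us
    using that
  proof (induction us)
    case (Cons u us)
    show ?case
    proof (cases "us = []")
      case False
      have "z O z \<subseteq> dist 0 u O dist 0 (concat us)" using Cons False by (intro relcomp_mono) auto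
      then show ?thesis by (simp add: dist0_append id)
    qed (use Cons in auto)
  qed simp
  have r: "reach (concat us) \<subseteq> r" if "us \<noteq> []" "\<forall>u\<in>set us. label_rep h u e" for us
    using that
  proof (induction us)
    case (Cons u us)
    show ?case
    proof (cases "us = []")
      case False
      have "reach u O reach (concat us) \<subseteq> r O r" using Cons False by (intro relcomp_mono) auto
      then show ?thesis by (simp add: reach_append id)
    qed (use Cons in auto)
  qed simp
  have zb: "z O b \<subseteq> b" by (rule relcomp_subset_absorb[OF id(4,2)])
  \<comment> \<open>Only the last factor may cost anything here, so the bound is independent of the
    number of factors. The first factor below adds the second \<open>?K\<close>.\<close>
  have tail: "z O b \<subseteq> dist ?K (concat us)" if "us \<noteq> []" "\<forall>u\<in>set us. label_rep h u e" for us
    using that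
  proof (induction us)
    case (Cons u us)
    show ?case
    proof (cases "us = []")
      case True
      then show ?thesis using zb Cons.prems by auto
    next
      case False
      have "z O (z O b) \<subseteq> dist 0 u O dist ?K (concat us)" using Cons False by (intro relcomp_mono) auto
      then show ?thesis using dist_comp[of 0 u ?K "concat us"] id(1) by (simp flip: O_assoc)
    qed
  qed simp
  obtain u us' where us': "us = u # us'" using us(1) by (cases us) auto
  have "b O z O b \<subseteq> dist (?K + ?K) (concat us)"
  proof (cases "us' = []")
    case True
    have "b O z O b \<subseteq> b O b" using zb by (intro relcomp_mono) auto
    also have "\<dots> \<subseteq> dist ?K u" using us us' id by auto
    finally show ?thesis using True us' dist_mono[of ?K "?K + ?K" u] by auto
  next
    case False
    have "b O (z O b) \<subseteq> dist ?K u O dist ?K (concat us')"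
      using tail[OF False] us us' by (intro relcomp_mono) auto
    then show ?thesis using dist_comp[of ?K u ?K "concat us'"] us' by auto
  qed
  moreover have "?K + ?K = 2 * length T * 2 ^ Suc h" by simp
  ultimately show "label_rep (Suc h) (concat us) (label_sharp e)" using z[OF us] r[OF us] by simp
qed

text \<open>A label is realized if it is the limit of the cost matrices of a sequence of words.\<close>
fun realized :: "label \<Rightarrow> bool" where
  "realized (z, b, r) \<longleftrightarrow> (\<forall>j. \<exists>u. dist 0 u \<subseteq> z \<and> dist j u \<subseteq> b \<and> r \<subseteq> reach u)"

definition realized_labels :: "label set" where
  "realized_labels = {c \<in> labels \<inter> Pow ({..<n} \<times> {..<n}) \<times> Pow ({..<n} \<times> {..<n}) \<times> Pow ({..<n} \<times> {..<n}). realized c}"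

text \<open>For budget \<open>j\<close> the witness is the power with \<open>j + 1\<close> factors
  of a word that realizes \<open>e\<close> for \<open>j\<close>. Idempotence keeps the free pairs
  within \<open>z\<close> and preserves all of \<open>r\<close>.\<close>

lemma realized_sharp:
  assumes e: "label_mul e e = e" "e \<in> labels" "realized e"
  shows "realized (label_sharp e)"
proof -
  obtain z b r where [simp]: "e = (z, b, r)" by (cases e)
  have id: "z O z = z" "b O b = b" "r O r = r" "z \<subseteq> b" using e by (auto simp: labels_def)
  have "\<exists>u. dist 0 u \<subseteq> z \<and> dist j u \<subseteq> b O z O b \<and> r \<subseteq> reach u" for j
  proof -
    obtain u where u: "dist 0 u \<subseteq> z" "dist j u \<subseteq> b" "r \<subseteq> reach u"
      using e(3)[simplified, rule_format, of j] by blast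
    define pw where "pw i = concat (replicate (Suc i) u)" for i
    have pw_Suc: "pw (Suc i) = u @ pw i" for i by (simp add: pw_def)
    have z: "dist 0 (pw i) \<subseteq> z" for i
    proof (induction i)
      case (Suc i)
      have "dist 0 u O dist 0 (pw i) \<subseteq> z O z" using u Suc by (intro relcomp_mono)
      then show ?case by (simp add: pw_Suc dist0_append id)
    qed (use u in \<open>simp add: pw_def\<close>)
    have r: "r \<subseteq> reach (pw i)" for i
    proof (induction i)
      case (Suc i)
      have "r O r \<subseteq> reach u O reach (pw i)" using u Suc by (intro relcomp_mono)
      then show ?case by (simp add: pw_Suc reach_append id)
    qed (use u in \<open>simp add: pw_def\<close>)
    have b: "dist i (pw l) \<subseteq> b" if "i \<le> j" for i l
      using that
    proof (induction l arbitrary: i)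
      case 0
      then show ?case using u(2) dist_mono[of i j u] by (auto simp: pw_def)
    next
      case (Suc l)
      have "dist i (pw (Suc l)) \<subseteq> dist i u O dist i (pw l)" unfolding pw_Suc by (rule dist_append_subset)
      also have "\<dots> \<subseteq> b O b" using Suc u(2) dist_mono[of i j u] by (intro relcomp_mono) auto
      finally show ?case by (simp add: id)
    qed
    have zb: "z \<subseteq> b O z O b"
    proof -
      have "z O z O z \<subseteq> b O z O b" using id(4) by (intro relcomp_mono) auto
      then show ?thesis by (simp add: id)
    qed
    \<comment> \<open>With more blocks than cost, some block is free.\<close>
    have "dist i (pw l) \<subseteq> b O z O b" if "i \<le> l" "i \<le> j" for i l
      using that
    proof (induction l arbitrary: i)
      case 0
      then show ?case using u(1) zb by (auto simp: pw_def)
    next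
      case (Suc l)
      show ?case
      proof
        fix x assume x: "x \<in> dist i (pw (Suc l))"
        obtain p q where pq: "x = (p, q)" by (cases x)
        obtain i' s where s: "i' \<le> i" "(p, s) \<in> dist i' u" "(s, q) \<in> dist (i - i') (pw l)"
          using dist_append[of p q i u "pw l"] x pq pw_Suc by auto
        show "x \<in> b O z O b"
        proof (cases "i' = 0")
          case True
          then have "(p, s) \<in> z" "(s, q) \<in> b" using s u(1) b[of i l] Suc.prems by auto
          then have "(p, q) \<in> z O b" by blast
          moreover have "z O b \<subseteq> b O z O b"
          proof -
            have "z O b = (z O z) O b" by (simp add: id)
            also have "\<dots> \<subseteq> b O z O b" using id(4) unfolding O_assoc by (intro relcomp_mono) auto
            finally show ?thesis .
          qed
          ultimately show ?thesis using pq by blast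
        next
          case False
          then have "i - i' \<le> l" "i - i' \<le> j" using Suc.prems by simp_all
          from Suc.IH[OF this] have "(s, q) \<in> b O z O b" using s(3) by (rule subsetD)
          moreover have "(p, s) \<in> b" using s(1,2) u(2) dist_mono[of i' j u] Suc.prems by auto
          ultimately have "(p, q) \<in> b O (b O z O b)" by blast
          then show ?thesis using pq id(2) by (simp flip: O_assoc)
        qed
      qed
    qed
    from this[of j j] show ?thesis using z r by blast
  qed
  then show ?thesis by simp
qed

lemma realized_mul:
  assumes "realized c" "realized d"
  shows "realized (label_mul c d)"
proof -
  obtain z b r z' b' r' where [simp]: "c = (z, b, r)" "d = (z', b', r')" by (cases c; cases d)
  have "\<exists>u. dist 0 u \<subseteq> z O z' \<and> dist j u \<subseteq> b O b' \<and> r O r' \<subseteq> reach u" for j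
  proof -
    obtain u v where u: "dist 0 u \<subseteq> z" "dist j u \<subseteq> b" "r \<subseteq> reach u"
      and v: "dist 0 v \<subseteq> z'" "dist j v \<subseteq> b'" "r' \<subseteq> reach v"
      using assms(1)[simplified, rule_format, of j] assms(2)[simplified, rule_format, of j] by blast
    have "dist j (u @ v) \<subseteq> b O b'"
      using dist_append_subset[of j u v] relcomp_mono[OF u(2) v(2)] by blast
    then show ?thesis using relcomp_mono[OF u(1) v(1)] relcomp_mono[OF u(3) v(3)]
      by (intro exI[of _ "u @ v"]) (simp add: dist0_append reach_append)
  qed
  then show ?thesis by simp
qed

lemma closed_realized: "closed realized_labels"
  unfolding closed_def
proof (intro conjI ballI impI)
  show "realized_labels \<subseteq> labels" "finite realized_labels" by (auto simp: realized_labels_def)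
next
  fix c d assume cd: "c \<in> realized_labels" "d \<in> realized_labels"
  obtain z b r z' b' r' where e: "c = (z, b, r)" "d = (z', b', r')" by (cases c; cases d)
  have "realized (label_mul c d)" using cd realized_mul by (simp add: realized_labels_def)
  moreover have "z O z' \<subseteq> b O b'" using cd e by (intro relcomp_mono) (auto simp: realized_labels_def labels_def)
  moreover have "x O y \<subseteq> {..<n} \<times> {..<n}" if "x \<subseteq> {..<n} \<times> {..<n}" "y \<subseteq> {..<n} \<times> {..<n}" for x y :: "nat rel"
    using that by blast
  ultimately show "label_mul c d \<in> realized_labels"
    using cd unfolding e realized_labels_def labels_def by simp
next
  fix e assume e: "e \<in> realized_labels" "label_mul e e = e"
  obtain z b r where zbr: "e = (z, b, r)" by (cases e)
  have id: "z O z = z" "b O b = b" "z \<subseteq> b" using e zbr by (auto simp: labels_def realized_labels_def)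
  have "realized (label_sharp e)" using e realized_sharp by (simp add: realized_labels_def)
  moreover have "z O z O z \<subseteq> b O z O b" using id(3) by (intro relcomp_mono) auto
  then have "z \<subseteq> b O z O b" by (simp add: id)
  moreover have "b O z O b \<subseteq> {..<n} \<times> {..<n}"
    using e zbr by (auto simp: realized_labels_def)
  ultimately show "label_sharp e \<in> realized_labels" using e zbr
    by (simp add: realized_labels_def labels_def)
qed

lemma card_realized: "card realized_labels \<le> 2 ^ (3 * n * n)"
proof -
  let ?P = "Pow ({..<n} \<times> {..<n})"
  have "card realized_labels \<le> card (?P \<times> ?P \<times> ?P)"
    by (intro card_mono) (auto simp: realized_labels_def)
  also have "\<dots> = 2 ^ (n * n) * (2 ^ (n * n) * 2 ^ (n * n))"
    by (simp add: card_cartesian_product card_Pow)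
  also have "\<dots> = 2 ^ (3 * n * n)" by (simp flip: power_add)
  finally show ?thesis .
qed

definition cost_bound :: nat where
  "cost_bound = 2 * length T * 2 ^ height_bound (2 ^ (3 * n * n))"

text \<open>A nonempty \<open>u\<close> has a label \<open>(z, b, r)\<close> that is also realized.
  So some \<open>v\<close> satisfies \<open>reach u \<subseteq> r \<subseteq> reach v\<close> and
  \<open>dist N v \<subseteq> b \<subseteq> dist cost_bound u\<close>, and \<open>lim\<close> is
  applied to \<open>v\<close>. The number \<open>N\<close> influences only the choice of
  \<open>v\<close>, not the constant.\<close>

theorem limited_by_cost_bound:
  assumes lim: "\<And>u. reach u \<inter> X \<noteq> {} \<Longrightarrow> dist N u \<inter> X \<noteq> {}"
    and u: "reach u \<inter> X \<noteq> {}"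
  shows "dist cost_bound u \<inter> X \<noteq> {}"
proof (cases "u = []")
  \<comment> \<open>Factorizations exist for nonempty words only.\<close>
  case True
  have "length T * 1 \<le> length T * (2 * 2 ^ height_bound (2 ^ (3 * n * n)))"
    by (intro mult_le_mono2) simp
  then have "reach u \<subseteq> dist cost_bound u"
    using reach_Nil dist_mono[of "length T" cost_bound "[]"] True by (simp add: cost_bound_def ac_simps)
  then show ?thesis using u by blast
next
  case False
  \<comment> \<open>For a single letter every reachable pair counts as bounded, by
    \<open>reach_letter\<close>; the word \<open>[a]\<close> realizes this label for every
    budget.\<close>
  define xs where "xs = map (\<lambda>a. ([a], (dist 0 [a], reach [a], reach [a]))) u"
  have letter: "(dist 0 [a], reach [a], reach [a]) \<in> realized_labels \<and>
    label_rep 0 [a] (dist 0 [a], reach [a], reach [a])" for a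
  proof
    have "dist j [a] \<subseteq> reach [a]" for j by (auto simp: reach_def)
    then have "realized (dist 0 [a], reach [a], reach [a])"
      unfolding realized.simps by (intro allI exI[of _ "[a]"]) simp
    then show "(dist 0 [a], reach [a], reach [a]) \<in> realized_labels"
      using dist_states reach_states \<open>\<And>j. dist j [a] \<subseteq> reach [a]\<close> by (simp add: realized_labels_def labels_def)
    show "label_rep 0 [a] (dist 0 [a], reach [a], reach [a])" using reach_letter by simp
  qed
  have "items 0 realized_labels xs" using letter by (auto simp: items_def xs_def)
  moreover have "xs \<noteq> []" "concat (map fst xs) = u" using False by (auto simp: xs_def comp_def)
  ultimately obtain c where c: "c \<in> realized_labels" "label_rep (height_bound (2 ^ (3 * n * n))) u c"
    using bounded_factorization[OF closed_realized card_realized, of 0, unfolded covered_def, rule_format, of xs]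
    by auto
  obtain z b r where zbr: "c = (z, b, r)" by (cases c)
  obtain v where v: "dist N v \<subseteq> b" "r \<subseteq> reach v"
  proof -
    have "realized (z, b, r)" using c(1) zbr by (simp add: realized_labels_def)
    from this[simplified, rule_format, of N] show thesis using that by blast
  qed
  have "reach v \<inter> X \<noteq> {}" using u c(2) zbr v(2) by auto
  then have "dist N v \<inter> X \<noteq> {}" by (rule lim)
  moreover have "b \<subseteq> dist cost_bound u" using c(2) zbr by (simp add: cost_bound_def)
  ultimately show ?thesis using v(1) by blast
qed

end

section \<open>Recognizable uniformization and bounded outputs\<close>

definition bounded_outputs :: "nat \<Rightarrow> (nat list \<times> nat list) set \<Rightarrow> bool" where
  "bounded_outputs N R \<longleftrightarrow> (\<forall>u\<in>Domain R. \<exists>v. (u, v) \<in> R \<and> length v \<le> N)"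

lemma bounded_outputs_mono: "bounded_outputs N R \<Longrightarrow> N \<le> N' \<Longrightarrow> bounded_outputs N' R"
  unfolding bounded_outputs_def by fastforce

text \<open>A product inside the graph of \<open>g\<close> with nonempty first factor has at most
  one second component, so \<open>g\<close> takes at most one value per product in
  \<open>F\<close>.\<close>

lemma uniformization_bounded:
  assumes "has_recognizable_uniformization m k R"
  shows "\<exists>N. bounded_outputs N R"
proof -
  obtain g where g: "\<forall>u\<in>Domain R. (u, g u) \<in> R" and rec: "recognizable m k {(u, g u) | u. u \<in> Domain R}"
    using assms unfolding has_recognizable_uniformization_def by (elim exE conjE)
  obtain F where F: "finite F" "{(u, g u) | u. u \<in> Domain R} = (\<Union>(U, V) \<in> F. U \<times> V)"
    using rec unfolding recognizable_def by (elim exE conjE)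
  have graph: "v = g u" if "(U, V) \<in> F" "u \<in> U" "v \<in> V" for u v U V
  proof -
    have "(u, v) \<in> {(u, g u) | u. u \<in> Domain R}" unfolding F(2) using that by blast
    then show ?thesis by simp
  qed
  have "g ` Domain R \<subseteq> (\<lambda>(U, V). g (SOME u. u \<in> U)) ` F"
  proof
    fix v assume "v \<in> g ` Domain R"
    then obtain u where u: "u \<in> Domain R" "v = g u" by blast
    then have "(u, v) \<in> {(u, g u) | u. u \<in> Domain R}" by blast
    then obtain U V where UV: "(U, V) \<in> F" "u \<in> U" "v \<in> V" unfolding F(2) by blast
    have "v = g (SOME u. u \<in> U)" using UV by (intro graph[OF UV(1)] someI[of "\<lambda>u. u \<in> U"])
    then show "v \<in> (\<lambda>(U, V). g (SOME u. u \<in> U)) ` F" using UV(1) by force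
  qed
  then have "finite (g ` Domain R)" using F(1) finite_surj by blast
  then obtain N where N: "\<forall>v\<in>g ` Domain R. length v < N" using finite_maxlen by blast
  have "bounded_outputs N R" unfolding bounded_outputs_def
  proof
    fix u assume u: "u \<in> Domain R"
    then have "length (g u) \<le> N" using N by (simp add: less_imp_le)
    then show "\<exists>v. (u, v) \<in> R \<and> length v \<le> N" using g u by blast
  qed
  then show ?thesis ..
qed

text \<open>This is a deterministic automaton with finite state set \<open>X\<close>; the injection
  \<open>f\<close> supplies the numeric states that \<open>nfa\<close> requires.\<close>

lemma regular_foldl:
  fixes m :: nat
  assumes X: "finite X" "x0 \<in> X" "\<And>x a. x \<in> X \<Longrightarrow> a < m \<Longrightarrow> \<delta> x a \<in> X"
  shows "regular {..<m} {u \<in> lists {..<m}. P (foldl \<delta> x0 u)}"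
proof -
  obtain f :: "'a \<Rightarrow> nat" where f: "inj_on f X" using finite_imp_inj_to_nat_seg[OF X(1)] by (elim exE conjE)
  have "finite (X \<times> {..<m})" using X(1) by (rule finite_cartesian_product) (rule finite_lessThan)
  then have "finite ((\<lambda>(x, a). (f x, a, f (\<delta> x a))) ` (X \<times> {..<m}))" by (rule finite_imageI)
  from finite_list[OF this]
  obtain T where T: "set T = (\<lambda>(x, a). (f x, a, f (\<delta> x a))) ` (X \<times> {..<m})" ..
  have "finite (f ` {x \<in> X. P x})" using X(1) by simp
  from finite_list[OF this] obtain fs where fs: "set fs = f ` {x \<in> X. P x}" ..
  have step: "(f x, a, r) \<in> set T \<longleftrightarrow> a < m \<and> r = f (\<delta> x a)" if x: "x \<in> X" for x a r
  proof
    assume "(f x, a, r) \<in> set T"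
    then obtain y where "y \<in> X" "f x = f y" "a < m" "r = f (\<delta> y a)" unfolding T by auto
    then show "a < m \<and> r = f (\<delta> x a)" using inj_onD[OF f, of x y] x by simp
  qed (use x in \<open>auto simp: T\<close>)
  have run: "path T (f x) u r \<longleftrightarrow> u \<in> lists {..<m} \<and> r = f (foldl \<delta> x u)" if "x \<in> X" for x u r
    using that
  proof (induction u arbitrary: x)
    case (Cons a u)
    show ?case
    proof (cases "a < m")
      case True
      then show ?thesis using Cons.IH[OF X(3)[OF Cons.prems True]] by (simp add: path_Cons_iff step[OF Cons.prems])
    qed (simp add: path_Cons_iff step[OF Cons.prems])
  qed auto
  have inX: "foldl \<delta> x u \<in> X" if "x \<in> X" "u \<in> lists {..<m}" for x u
    using that
  proof (induction u arbitrary: x)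
    case (Cons a u)
    then show ?case using X(3)[of x a] by simp
  qed simp
  have final: "f x \<in> set fs \<longleftrightarrow> P x" if x: "x \<in> X" for x
    unfolding fs using inj_onD[OF f _ x] x by blast
  have "u \<in> lang (NFA T [f x0] fs) \<longleftrightarrow> u \<in> lists {..<m} \<and> P (foldl \<delta> x0 u)" for u
  proof -
    have "u \<in> lang (NFA T [f x0] fs) \<longleftrightarrow> u \<in> lists {..<m} \<and> f (foldl \<delta> x0 u) \<in> set fs"
      unfolding lang_def by (simp add: run[OF X(2)])
    then show ?thesis using final inX[OF X(2)] by blast
  qed
  then have "lang (NFA T [f x0] fs) = {u \<in> lists {..<m}. P (foldl \<delta> x0 u)}" by blast
  then show ?thesis unfolding regular_def by (intro conjI exI[of _ "NFA T [f x0] fs"]) auto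
qed

lemma take_take_append: "take n (take n x @ y) = take n (x @ y)"
  by (cases "length x \<le> n") auto

text \<open>The automaton stores its input up to length \<open>Suc (length v)\<close>, one letter
  more than \<open>v\<close>, so that proper extensions of \<open>v\<close> are rejected.\<close>

lemma regular_singleton:
  fixes v :: "nat list"
  assumes "v \<in> lists {..<k}"
  shows "regular {..<k} {v}"
proof -
  define \<delta> where "\<delta> s a = take (Suc (length v)) (s @ [a])" for s and a :: nat
  have fold: "foldl \<delta> [] u = take (Suc (length v)) u" for u :: "nat list"
    by (induction u rule: rev_induct) (simp_all add: \<delta>_def take_take_append del: take_append)
  have "regular {..<k} {u \<in> lists {..<k}. foldl \<delta> [] u = v}"
  proof (rule regular_foldl)
    show "finite {xs. set xs \<subseteq> {..<k} \<and> length xs \<le> Suc (length v)}"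
      by (rule finite_lists_length_le) simp
  qed (auto simp: \<delta>_def dest!: in_set_takeD)
  moreover have "{u \<in> lists {..<k}. foldl \<delta> [] u = v} = {v}"
  proof -
    have "u = v" if "take (Suc (length v)) u = v" for u :: "nat list"
    proof -
      have "min (length u) (Suc (length v)) = length v" using arg_cong[OF that, of length] by simp
      then have "length u = length v" by linarith
      then show ?thesis using that by simp
    qed
    then show ?thesis unfolding fold using assms by auto
  qed
  ultimately show ?thesis by simp
qed

text \<open>The truncation length \<open>Suc N\<close> still tells
  whether an output is longer than N.\<close>
definition config :: "(nat + nat) nfa \<Rightarrow> nat \<Rightarrow> nat list \<Rightarrow> (nat \<times> nat list) set" where
  "config A N u = {(q, z). \<exists>p\<in>set (inits A). \<exists>w. path (trans A) p w q \<and> pi_in w = u \<and> z = take (Suc N) (pi_out w)}"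

definition config_step :: "(nat + nat) nfa \<Rightarrow> nat \<Rightarrow> (nat \<times> nat list) set \<Rightarrow> nat \<Rightarrow> (nat \<times> nat list) set" where
  "config_step A N X a = {(q', z'). \<exists>(q, z)\<in>X. \<exists>w. path (trans A) q w q' \<and> pi_in w = [a] \<and>
    z' = take (Suc N) (z @ pi_out w)}"

text \<open>Truncating before and after appending equals truncating once, so configurations can be
  updated deterministically along the input.\<close>

lemma config_snoc: "config A N (u @ [a]) = config_step A N (config A N u) a"
proof (intro equalityI subrelI)
  fix q z assume "(q, z) \<in> config A N (u @ [a])"
  then obtain p w where w: "p \<in> set (inits A)" "path (trans A) p w q" "pi_in w = u @ [a]"
    "z = take (Suc N) (pi_out w)" by (auto simp: config_def)
  from pi_in_eq_append[OF w(3)] obtain w1 w2 where ww: "w = w1 @ w2" "pi_in w1 = u" "pi_in w2 = [a]" by blast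
  then obtain r where r: "path (trans A) p w1 r" "path (trans A) r w2 q" using w(2) by (auto simp: path_append)
  have "(r, take (Suc N) (pi_out w1)) \<in> config A N u" using w(1) r(1) ww(2) unfolding config_def by blast
  moreover have "z = take (Suc N) (take (Suc N) (pi_out w1) @ pi_out w2)"
    using w(4) ww(1) by (simp only: take_take_append pi_out_append)
  ultimately show "(q, z) \<in> config_step A N (config A N u) a"
    using r(2) ww(3) unfolding config_step_def by blast
next
  fix q z assume "(q, z) \<in> config_step A N (config A N u) a"
  then obtain p w r w' where w: "p \<in> set (inits A)" "path (trans A) p w r" "pi_in w = u"
    "path (trans A) r w' q" "pi_in w' = [a]" "z = take (Suc N) (take (Suc N) (pi_out w) @ pi_out w')"
    unfolding config_step_def config_def by blast
  have "path (trans A) p (w @ w') q" "pi_in (w @ w') = u @ [a]" "z = take (Suc N) (pi_out (w @ w'))"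
    using w unfolding path_append by (auto simp only: take_take_append pi_out_append pi_in_append)
  then show "(q, z) \<in> config A N (u @ [a])" using w(1) unfolding config_def by blast
qed

lemma config_append: "config A N (u @ v) = foldl (config_step A N) (config A N u) v"
proof (induction v rule: rev_induct)
  case (snoc a v)
  then show ?case using config_snoc[of A N "u @ v" a] by simp
qed simp

lemma rat_rel_iff: "(u, v) \<in> rat_rel A \<longleftrightarrow> (\<exists>p\<in>set (inits A). \<exists>q\<in>set (finals A). \<exists>w.
    path (trans A) p w q \<and> pi_in w = u \<and> pi_out w = v)"
  unfolding rat_rel_def lang_def sem_def by auto

lemma Domain_config: "u \<in> Domain (rat_rel A) \<longleftrightarrow> (\<exists>q\<in>set (finals A). \<exists>z. (q, z) \<in> config A N u)"
  unfolding Domain_iff rat_rel_iff config_def by auto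

lemma take_Suc_short: "length v \<le> N \<Longrightarrow> v = take (Suc N) x \<longleftrightarrow> x = v"
proof
  assume v: "length v \<le> N" "v = take (Suc N) x"
  then have "min (length x) (Suc N) \<le> N" by simp
  then show "x = v" using v(2) by simp
qed auto

lemma rat_rel_config:
  "length v \<le> N \<Longrightarrow> (u, v) \<in> rat_rel A \<longleftrightarrow> (\<exists>q\<in>set (finals A). (q, v) \<in> config A N u)"
  unfolding rat_rel_iff config_def by (auto simp: take_Suc_short)

text \<open>Whether a short output exists depends on \<open>u\<close> only through its
  configuration. Pumping may therefore change the input as long as the configuration is
  preserved.\<close>

lemma short_output_config:
  "(\<exists>v. (u, v) \<in> rat_rel A \<and> length v \<le> N) \<longleftrightarrow>
    (\<exists>q\<in>set (finals A). \<exists>v. length v \<le> N \<and> (q, v) \<in> config A N u)"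
  using rat_rel_config by blast

locale bounded_nfa =
  fixes A :: "(nat + nat) nfa" and n m k :: nat
  assumes wf: "wf_input m k A"
    and trans_states: "(p, c, q) \<in> set (trans A) \<Longrightarrow> p < n \<and> q < n"
    and inits_states: "set (inits A) \<subseteq> {..<n}"
begin

sublocale distance_automaton "trans A" n
  by standard (rule trans_states)

lemma path_letters: "path (trans A) p w q \<Longrightarrow> set (pi_in w) \<subseteq> {..<m} \<and> set (pi_out w) \<subseteq> {..<k}"
proof (induction w arbitrary: p rule: pi_in.induct)
  case (2 a w)
  then obtain r where r: "(p, Inl a, r) \<in> set (trans A)" "path (trans A) r w q" by (auto simp: path_Cons_iff)
  have "a < m" using wf r(1) unfolding wf_input_def mixed_alph_def by fastforce
  then show ?case using 2(1)[OF r(2)] by simp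
next
  case (3 b w)
  then obtain r where r: "(p, Inr b, r) \<in> set (trans A)" "path (trans A) r w q" by (auto simp: path_Cons_iff)
  have "b < k" using wf r(1) unfolding wf_input_def mixed_alph_def by fastforce
  then show ?case using 3(1)[OF r(2)] by simp
qed simp

definition short_words :: "nat \<Rightarrow> nat list set" where
  "short_words N = {v. set v \<subseteq> {..<k} \<and> length v \<le> N}"

lemma finite_short_words: "finite (short_words N)"
  unfolding short_words_def by (rule finite_lists_length_le) simp

lemma card_short_words: "card (short_words N) \<le> Suc N * (k + 1) ^ N"
proof -
  have "card (short_words N) = (\<Sum>i\<le>N. k ^ i)"
    unfolding short_words_def by (subst card_lists_length_le) auto
  also have "\<dots> \<le> (\<Sum>i\<le>N. (k + 1) ^ N)"
  proof (intro sum_mono)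
    fix i assume "i \<in> {..N}"
    have "k ^ i \<le> (k + 1) ^ i" by (rule power_mono) auto
    also have "\<dots> \<le> (k + 1) ^ N" using \<open>i \<in> {..N}\<close> by (intro power_increasing) auto
    finally show "k ^ i \<le> (k + 1) ^ N" .
  qed
  finally show ?thesis by simp
qed

lemma config_subset: "config A N u \<subseteq> {..<n} \<times> short_words (Suc N)"
proof
  fix x assume "x \<in> config A N u"
  then obtain p w where w: "p \<in> set (inits A)" "path (trans A) p w (fst x)" "snd x = take (Suc N) (pi_out w)"
    by (auto simp: config_def)
  have "fst x < n" using path_state[OF w(2)] inits_states w(1) by auto
  moreover have "set (snd x) \<subseteq> {..<k}" using path_letters[OF w(2)] w(3) set_take_subset by fastforce
  ultimately show "x \<in> {..<n} \<times> short_words (Suc N)"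
    using w(3) by (cases x) (simp add: short_words_def)
qed

lemma config_finite: "finite (Pow ({..<n} \<times> short_words (Suc N)))"
  using finite_short_words by simp

lemma config_step_subset:
  assumes "X \<subseteq> {..<n} \<times> short_words (Suc N)"
  shows "config_step A N X a \<subseteq> {..<n} \<times> short_words (Suc N)"
proof
  fix x assume "x \<in> config_step A N X a"
  then obtain q z w where w: "(q, z) \<in> X" "path (trans A) q w (fst x)" "snd x = take (Suc N) (z @ pi_out w)"
    by (auto simp: config_step_def)
  have qz: "q < n" "set z \<subseteq> {..<k}" using assms w(1) by (auto simp: short_words_def)
  have "fst x < n" using path_state[OF w(2) qz(1)] .
  moreover have "set (snd x) \<subseteq> set (z @ pi_out w)" using w(3) set_take_subset by metis
  ultimately show "x \<in> {..<n} \<times> short_words (Suc N)"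
    using w(3) path_letters[OF w(2)] qz by (cases x) (auto simp: short_words_def)
qed

text \<open>The output is a fixed choice made from the configuration, so inputs with equal
  configurations get equal outputs. Hence the preimage of each of the finitely many short outputs is
  recognized by the automaton of configurations.\<close>

theorem bounded_uniformization:
  assumes N: "bounded_outputs N (rat_rel A)"
  shows "has_recognizable_uniformization m k (rat_rel A)"
proof -
  let ?R = "rat_rel A"
  define out where "out X v \<longleftrightarrow> length v \<le> N \<and> (\<exists>q\<in>set (finals A). (q, v) \<in> X)" for X :: "(nat \<times> nat list) set" and v
  define g where "g u = (SOME v. out (config A N u) v)" for u
  have g: "out (config A N u) (g u)" if "u \<in> Domain ?R" for u
  proof -
    have "\<exists>v. out (config A N u) v"
      using N that unfolding bounded_outputs_def out_def short_output_config by blast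
    then show ?thesis unfolding g_def by (rule someI_ex)
  qed
  have gR: "(u, g u) \<in> ?R" "length (g u) \<le> N" if "u \<in> Domain ?R" for u
    using g[OF that] rat_rel_config[of "g u" N u A] unfolding out_def by auto
  have dom: "u \<in> lists {..<m}" if u: "u \<in> Domain ?R" for u
  proof -
    obtain v p q w where "path (trans A) p w q" "pi_in w = u" using u unfolding Domain_iff rat_rel_iff by blast
    then show ?thesis using path_letters by auto
  qed
  have words: "g u \<in> short_words N" if u: "u \<in> Domain ?R" for u
  proof -
    obtain p q w where w: "path (trans A) p w q" "pi_out w = g u" using gR(1)[OF u] unfolding rat_rel_iff by blast
    show ?thesis using path_letters[OF w(1)] w(2) gR(2)[OF u] by (simp add: short_words_def)
  qed
  define F where "F = (\<lambda>v. ({u \<in> Domain ?R. g u = v}, {v})) ` short_words N"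
  have reg1: "regular {..<m} {u \<in> Domain ?R. g u = v}" for v
  proof -
    define P where "P X \<longleftrightarrow> (\<exists>q\<in>set (finals A). \<exists>z. (q, z) \<in> X) \<and> (SOME v. out X v) = v" for X
    have "regular {..<m} {u \<in> lists {..<m}. P (foldl (config_step A N) (config A N []) u)}"
      by (rule regular_foldl[OF config_finite[of N]]) (use config_subset config_step_subset in auto)
    moreover have "{u \<in> lists {..<m}. P (foldl (config_step A N) (config A N []) u)} = {u \<in> Domain ?R. g u = v}"
      unfolding P_def config_append[symmetric, of A N "[]", simplified] g_def[symmetric] Domain_config[symmetric]
      using dom by auto
    ultimately show ?thesis by simp
  qed
  have reg2: "regular {..<k} {v}" if "v \<in> short_words N" for v
    using that by (intro regular_singleton) (auto simp: short_words_def)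
  have "recognizable m k {(u, g u) | u. u \<in> Domain ?R}"
    unfolding recognizable_def
  proof (intro exI[of _ F] conjI)
    show "finite F" unfolding F_def using finite_short_words by simp
    show "\<forall>(U, V)\<in>F. regular {..<m} U \<and> regular {..<k} V" unfolding F_def using reg1 reg2 by auto
    show "{(u, g u) | u. u \<in> Domain ?R} = (\<Union>(U, V) \<in> F. U \<times> V)"
      unfolding F_def using words by auto
  qed
  then show ?thesis unfolding has_recognizable_uniformization_def using gR(1) by blast
qed

lemma rat_rel_dist:
  "(\<exists>v. (u, v) \<in> rat_rel A \<and> length v \<le> N) \<longleftrightarrow> dist N u \<inter> set (inits A) \<times> set (finals A) \<noteq> {}"
proof
  assume "\<exists>v. (u, v) \<in> rat_rel A \<and> length v \<le> N"
  then obtain p q w where w: "p \<in> set (inits A)" "q \<in> set (finals A)" "path (trans A) p w q"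
    "pi_in w = u" "length (pi_out w) \<le> N" unfolding rat_rel_iff by blast
  then have "(p, q) \<in> dist N u" using inits_states unfolding dist_def by blast
  then show "dist N u \<inter> set (inits A) \<times> set (finals A) \<noteq> {}" using w by blast
next
  assume "dist N u \<inter> set (inits A) \<times> set (finals A) \<noteq> {}"
  then obtain p q where "(p, q) \<in> dist N u" "p \<in> set (inits A)" "q \<in> set (finals A)" by blast
  then show "\<exists>v. (u, v) \<in> rat_rel A \<and> length v \<le> N" unfolding dist_def rat_rel_iff by blast
qed

lemma Domain_reach: "u \<in> Domain (rat_rel A) \<longleftrightarrow> reach u \<inter> set (inits A) \<times> set (finals A) \<noteq> {}"
proof -
  have "u \<in> Domain (rat_rel A) \<longleftrightarrow> (\<exists>N v. (u, v) \<in> rat_rel A \<and> length v \<le> N)" by blast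
  also have "\<dots> \<longleftrightarrow> (\<exists>N. dist N u \<inter> set (inits A) \<times> set (finals A) \<noteq> {})"
    by (simp only: rat_rel_dist)
  also have "\<dots> \<longleftrightarrow> reach u \<inter> set (inits A) \<times> set (finals A) \<noteq> {}" unfolding reach_def by blast
  finally show ?thesis .
qed

theorem uniformization_iff_cost_bound:
  "has_recognizable_uniformization m k (rat_rel A) \<longleftrightarrow> bounded_outputs cost_bound (rat_rel A)"
proof
  assume "has_recognizable_uniformization m k (rat_rel A)"
  then obtain N where N: "bounded_outputs N (rat_rel A)" using uniformization_bounded by blast
  have lim: "dist N u \<inter> set (inits A) \<times> set (finals A) \<noteq> {}"
    if "reach u \<inter> set (inits A) \<times> set (finals A) \<noteq> {}" for u
    using bspec[OF N[unfolded bounded_outputs_def rat_rel_dist] Domain_reach[THEN iffD2, OF that]] .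
  show "bounded_outputs cost_bound (rat_rel A)"
    unfolding bounded_outputs_def rat_rel_dist
  proof
    fix u assume "u \<in> Domain (rat_rel A)"
    then show "dist cost_bound u \<inter> set (inits A) \<times> set (finals A) \<noteq> {}"
      unfolding Domain_reach by (rule limited_by_cost_bound[of _ N, rotated]) (rule lim)
  qed
qed (rule bounded_uniformization)

text \<open>Bounds the number of pairs of a state and a configuration, using the closed formula of
  \<open>card_short_words\<close> to stay visibly computable.\<close>

definition run_bound :: "nat \<Rightarrow> nat" where
  "run_bound N = n * 2 ^ (n * (Suc (Suc N) * (k + 1) ^ Suc N))"

text \<open>A long run visits some state twice with the same configuration of the input read so far.
  Cutting the part in between preserves the end state and the final configuration, although the
  input may change.\<close>

lemma shorten_run:
  assumes "path (trans A) p w q" "p \<in> set (inits A)"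
  shows "\<exists>w'. path (trans A) p w' q \<and> config A N (pi_in w') = config A N (pi_in w) \<and> length w' < run_bound N"
  using assms
proof (induction "length w" arbitrary: w rule: less_induct)
  case less
  show ?case
  proof (cases "length w < run_bound N")
    case True
    then show ?thesis using less.prems by blast
  next
    case False
    have "\<exists>r. path (trans A) p (take i w) r \<and> path (trans A) r (drop i w) q" for i
      using less.prems(1) path_append[of "trans A" p "take i w" "drop i w" q] by simp
    then obtain s where s: "\<And>i. path (trans A) p (take i w) (s i)" "\<And>i. path (trans A) (s i) (drop i w) q"
      by metis
    define f where "f i = (s i, config A N (pi_in (take i w)))" for i
    let ?C = "{..<n} \<times> Pow ({..<n} \<times> short_words (Suc N))"
    have "p < n" using less.prems(2) inits_states by blast
    then have "f i \<in> ?C" for i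
      using path_state[OF s(1)] config_subset unfolding f_def by (intro SigmaI PowI) simp_all
    then have "f ` {..length w} \<subseteq> ?C" by blast
    moreover have "card ?C < card {..length w}"
    proof -
      have "card ?C = n * 2 ^ (n * card (short_words (Suc N)))"
        using finite_short_words by (simp add: card_cartesian_product card_Pow)
      also have "\<dots> \<le> run_bound N"
        unfolding run_bound_def using card_short_words[of "Suc N"]
        by (intro mult_le_mono2 power_increasing) auto
      finally show ?thesis using False by simp
    qed
    ultimately have "\<not> inj_on f {..length w}"
      using card_inj_on_le[of f "{..length w}" ?C] finite_short_words by auto
    then obtain i j where ij: "i < j" "j \<le> length w" "f i = f j"
      unfolding inj_on_def by (metis atMost_iff linorder_neqE_nat)
    define w' where "w' = take i w @ drop j w"
    have "length w' < length w" using ij by (simp add: w'_def)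
    moreover have "path (trans A) p w' q"
      using s(1)[of i] s(2)[of j] ij(3) unfolding w'_def path_append f_def by auto
    ultimately obtain w'' where w'': "path (trans A) p w'' q" "config A N (pi_in w'') = config A N (pi_in w')"
      "length w'' < run_bound N" using less.hyps[of w'] less.prems(2) by blast
    have "config A N (pi_in w') = config A N (pi_in (take j w) @ pi_in (drop j w))"
      using ij(3) unfolding w'_def f_def by (simp add: config_append)
    also have "pi_in (take j w) @ pi_in (drop j w) = pi_in w" by (simp flip: pi_in_append)
    finally show ?thesis using w'' by metis
  qed
qed

theorem bounded_outputs_short_runs:
  assumes "\<And>p w q. p \<in> set (inits A) \<Longrightarrow> q \<in> set (finals A) \<Longrightarrow> path (trans A) p w q \<Longrightarrow>
    length w < run_bound N \<Longrightarrow> \<exists>v. (pi_in w, v) \<in> rat_rel A \<and> length v \<le> N"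
  shows "bounded_outputs N (rat_rel A)"
  unfolding bounded_outputs_def
proof
  fix u assume "u \<in> Domain (rat_rel A)"
  then obtain p q w where w: "p \<in> set (inits A)" "q \<in> set (finals A)" "path (trans A) p w q" "pi_in w = u"
    unfolding Domain_iff rat_rel_iff by blast
  from shorten_run[OF w(3,1), of N] obtain w' where w': "path (trans A) p w' q"
    "config A N (pi_in w') = config A N (pi_in w)" "length w' < run_bound N" by blast
  show "\<exists>v. (u, v) \<in> rat_rel A \<and> length v \<le> N"
    using assms[OF w(1,2) w'(1,3)] w'(2) w(4) unfolding short_output_config by simp
qed

end

section \<open>The decision procedure\<close>

lemma cf_height_bound: "cf f \<Longrightarrow> cf (\<lambda>x. height_bound (f x))"
proof -
  assume f: "cf f"
  have *: "rec_nat 0 (\<lambda>s r. Suc s * (r + 4 * Suc s + 10)) x = height_bound x" for x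
    by (induction x) simp_all
  have "cf (\<lambda>x. rec_nat 0 (\<lambda>s r. Suc s * (r + 4 * Suc s + 10)) (f x))"
    by (intro cf_rec f cf_const cf_mult cf_add cf_Suc cf_pf cf_ps cf_id)
  then show ?thesis by (simp only: *)
qed

text \<open>Bounds the codes of the lists of length at most l with entries at most a.\<close>
definition list_bound :: "nat \<Rightarrow> nat \<Rightarrow> nat" where
  "list_bound a l = rec_nat 0 (\<lambda>_ r. Suc (pp a r)) l"

lemma cf_list_bound:
  assumes f: "cf f" and g: "cf g"
  shows "cf (\<lambda>x. list_bound (f x) (g x))"
  unfolding list_bound_def by (intro f g cf_rec cf_const cf_Suc cf_pp cf_comp[OF f] cf_pf cf_ps cf_id)

lemma pp_mono: "a \<le> a' \<Longrightarrow> b \<le> b' \<Longrightarrow> pp a b \<le> pp a' b'"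
  unfolding pp_def prod_encode_def by (simp add: add_mono triangle_mono)

lemma list_encode_bound: "length zs \<le> l \<Longrightarrow> \<forall>z\<in>set zs. z \<le> a \<Longrightarrow> list_encode zs \<le> list_bound a l"
proof (induction zs arbitrary: l)
  case (Cons z zs)
  then obtain l' where l': "l = Suc l'" by (cases l) auto
  have "list_encode zs \<le> list_bound a l'" using Cons l' by simp
  then have "pp z (list_encode zs) \<le> pp a (list_bound a l')" using Cons.prems by (intro pp_mono) auto
  then show ?case using l' by (simp add: list_bound_def flip: pp_def)
qed simp

lemma member_le_list_encode: "z \<in> set zs \<Longrightarrow> z \<le> list_encode zs"
proof (induction zs)
  case (Cons y zs)
  then show ?case
    using le_prod_encode_1[of y "list_encode zs"] le_prod_encode_2[of "list_encode zs" y] by auto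
qed simp

lemma length_le_list_encode: "length zs \<le> list_encode zs"
  by (induction zs) (auto intro: order_trans le_prod_encode_2)

definition trans_part :: "nat \<Rightarrow> nat" where "trans_part a = pf (a - 1)"
definition inits_part :: "nat \<Rightarrow> nat" where "inits_part a = pf (ps (a - 1) - 1)"
definition finals_part :: "nat \<Rightarrow> nat" where "finals_part a = pf (ps (ps (a - 1) - 1) - 1)"

lemma code_parts [simp]:
  "trans_part (nfa_code A) = list_encode (map trans_code (trans A))"
  "inits_part (nfa_code A) = list_encode (inits A)"
  "finals_part (nfa_code A) = list_encode (finals A)"
  by (simp_all add: trans_part_def inits_part_def finals_part_def nfa_code_def flip: pp_def)

text \<open>A state of the run simulation consists of the successor of the current automaton state (or 0
  after a failure), the code of the reversed input read so far, and the number of outputs.\<close>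
definition sim_step :: "nat \<Rightarrow> nat \<Rightarrow> nat \<Rightarrow> nat" where
  "sim_step a s z = (if z \<in> set (list_decode (trans_part a)) \<and> pf s = Suc (pf z) then
     pp (Suc (ps (ps z)))
      (if even (pf (ps z)) then pp (Suc (pp (pf (ps z)) (pf (ps s)))) (ps (ps s))
       else pp (pf (ps s)) (Suc (ps (ps s))))
   else 0)"

definition sim :: "nat \<Rightarrow> nat \<Rightarrow> nat" where
  "sim a x = foldl (sim_step a) (pp (Suc (pf x)) 0) (list_decode (ps x))"

definition accepts :: "nat \<Rightarrow> nat \<Rightarrow> bool" where
  "accepts a x \<longleftrightarrow> pf x \<in> set (list_decode (inits_part a)) \<and> pf (sim a x) \<noteq> 0 \<and>
     pf (sim a x) - 1 \<in> set (list_decode (finals_part a))"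

text \<open>This is \<open>cost_bound\<close> with the code \<open>a\<close> in place of the number
  of transitions and \<open>Suc a\<close> in place of \<open>n\<close>; lists and their entries are
  bounded by their codes.\<close>

definition output_bound :: "nat \<Rightarrow> nat" where
  "output_bound a = 2 * a * 2 ^ height_bound (2 ^ (3 * Suc a * Suc a))"

definition length_bound :: "nat \<Rightarrow> nat \<Rightarrow> nat" where
  "length_bound k a = Suc a * 2 ^ (Suc a * (Suc (Suc (output_bound a)) * (k + 1) ^ Suc (output_bound a)))"

definition code_bound :: "nat \<Rightarrow> nat \<Rightarrow> nat" where
  "code_bound a l = Suc (pp a (list_bound a l))"

text \<open>A number codes a start state and a list of transitions. The tested \<open>x\<close>
  include codes of all accepting runs shorter than \<open>length_bound\<close>. A competitor
  \<open>y\<close> has the same input and few outputs, so its run need not be longer than that of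
  \<open>x\<close> plus \<open>output_bound\<close>. The run of \<open>x\<close> is only known to be
  no longer than \<open>x\<close> itself, which explains the nested
  \<open>code_bound\<close>.\<close>

definition decider :: "nat \<Rightarrow> nat \<Rightarrow> bool" where
  "decider k a \<longleftrightarrow> (\<forall>x<code_bound a (length_bound k a). accepts a x \<longrightarrow>
     (\<exists>y<code_bound a (code_bound a (length_bound k a) + output_bound a).
        accepts a y \<and> pf (ps (sim a y)) = pf (ps (sim a x)) \<and> ps (ps (sim a y)) \<le> output_bound a))"

lemma cp_even: "cf f \<Longrightarrow> cp (\<lambda>x. even (f x))"
proof -
  assume f: "cf f"
  have *: "rec_nat 0 (\<lambda>_ r. 1 - r) x = (0 :: nat) \<longleftrightarrow> even x" for x
  proof -
    have "rec_nat 0 (\<lambda>_ r. 1 - r) x = (if even x then 0 else 1 :: nat)" by (induction x) auto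
    then show ?thesis by simp
  qed
  have "cp (\<lambda>x. rec_nat 0 (\<lambda>_ r. 1 - r) (f x) = (0 :: nat))"
    by (intro cp_eq0 cf_rec f cf_const cf_diff cf_pf cf_ps cf_id)
  then show ?thesis by (simp only: *)
qed

lemma cf_parts: "cf f \<Longrightarrow> cf (\<lambda>x. trans_part (f x))" "cf f \<Longrightarrow> cf (\<lambda>x. inits_part (f x))"
  "cf f \<Longrightarrow> cf (\<lambda>x. finals_part (f x))"
  unfolding trans_part_def inits_part_def finals_part_def
  by (intro cf_pf cf_ps cf_diff cf_const; assumption)+

lemma cf_sim_step: "cf f \<Longrightarrow> cf g \<Longrightarrow> cf h \<Longrightarrow> cf (\<lambda>x. sim_step (f x) (g x) (h x))"
  unfolding sim_step_def
  by (intro cf_if cp_conj cp_mem cp_eq cp_even cf_parts cf_pp cf_Suc cf_pf cf_ps cf_const)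

lemma cf_sim:
  assumes f: "cf f" and g: "cf g"
  shows "cf (\<lambda>x. sim (f x) (g x))"
  unfolding sim_def
  by (intro f g cf_foldl cf_sim_step cf_comp[OF f] cf_pp cf_Suc cf_pf cf_ps cf_const cf_id)

lemma cp_accepts: "cf f \<Longrightarrow> cf g \<Longrightarrow> cp (\<lambda>x. accepts (f x) (g x))"
  unfolding accepts_def
  by (intro cp_conj cp_not cp_mem cp_eq0 cf_parts cf_sim cf_diff cf_pf cf_const)

lemma cf_bounds: "cf f \<Longrightarrow> cf (\<lambda>x. output_bound (f x))" "cf f \<Longrightarrow> cf (\<lambda>x. length_bound k (f x))"
  unfolding length_bound_def output_bound_def
  by (intro cf_mult cf_power cf_Suc cf_add cf_height_bound cf_const; assumption)+

lemma cf_code_bound: "cf f \<Longrightarrow> cf g \<Longrightarrow> cf (\<lambda>x. code_bound (f x) (g x))"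
  unfolding code_bound_def by (intro cf_Suc cf_pp cf_list_bound)

lemma cp_decider: "cp (decider k)"
  unfolding decider_def
  by (intro cp_all cp_ex cp_imp cp_conj cp_accepts cp_eq cp_le cf_code_bound cf_bounds cf_sim cf_add cf_pf cf_ps cf_id)

lemma letter_code_inj: "letter_code c = letter_code d \<Longrightarrow> c = d"
  by (cases c; cases d) (auto, presburger+)

lemma trans_code_pp: "trans_code (p, c, q) = pp p (pp (letter_code c) q)"
  by (simp add: pp_def)

lemma trans_code_mem:
  "pp p (pp (letter_code c) q) \<in> set (list_decode (trans_part (nfa_code A))) \<longleftrightarrow> (p, c, q) \<in> set (trans A)"
proof -
  have "inj trans_code"
    by (rule injI) (auto simp: trans_code_pp pp_def dest: letter_code_inj)
  then show ?thesis
    unfolding trans_code_pp[symmetric] by (simp add: inj_image_mem_iff del: trans_code.simps)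
qed

text \<open>This is the stack built by \<open>sim_step\<close>: the list code of the reversed input,
  with letters represented by their even codes. Injectivity allows inputs of two runs to be compared
  as numbers.\<close>

definition input_code :: "nat \<Rightarrow> nat list \<Rightarrow> nat" where
  "input_code i u = foldl (\<lambda>i a. Suc (pp (2 * a) i)) i u"

lemma input_code_inj: "input_code 0 u = input_code 0 v \<Longrightarrow> u = v"
proof -
  have *: "input_code (list_encode zs) u = list_encode (rev (map (\<lambda>a. 2 * a) u) @ zs)" for zs u
  proof (induction u arbitrary: zs)
    case (Cons a u)
    then show ?case using Cons[of "2 * a # zs"] by (simp add: input_code_def pp_def)
  qed (simp add: input_code_def)
  assume "input_code 0 u = input_code 0 v"
  then have "rev (map (\<lambda>a. 2 * a) u) = rev (map (\<lambda>a. 2 * a) v)"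
    using *[of "[]"] by (auto simp: list_encode_eq)
  then show "u = v" by (simp add: inj_map_eq_map inj_def)
qed

lemma sim_step_trans:
  assumes "(p, c, q) \<in> set (trans A)"
  shows "sim_step (nfa_code A) (pp (Suc p) (pp i j)) (trans_code (p, c, q)) =
    (case c of Inl a \<Rightarrow> pp (Suc q) (pp (Suc (pp (2 * a) i)) j) | Inr b \<Rightarrow> pp (Suc q) (pp i (Suc j)))"
  using assms trans_code_mem[of p c q A] unfolding sim_step_def trans_code_pp by (cases c) simp_all

lemma path_sim:
  "path (trans A) p w q \<Longrightarrow> \<exists>zs. length zs = length w \<and> set zs \<subseteq> trans_code ` set (trans A) \<and>
    foldl (sim_step (nfa_code A)) (pp (Suc p) (pp i j)) zs
      = pp (Suc q) (pp (input_code i (pi_in w)) (j + length (pi_out w)))"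
proof (induction w arbitrary: p i j)
  case Nil
  then show ?case by (intro exI[of _ "[]"]) (simp add: input_code_def)
next
  case (Cons c w)
  then obtain r where r: "(p, c, r) \<in> set (trans A)" "path (trans A) r w q" by (auto simp: path_Cons_iff)
  define i' where "i' = (case c of Inl a \<Rightarrow> Suc (pp (2 * a) i) | Inr b \<Rightarrow> i)"
  define j' where "j' = (case c of Inl a \<Rightarrow> j | Inr b \<Rightarrow> Suc j)"
  obtain zs where zs: "length zs = length w" "set zs \<subseteq> trans_code ` set (trans A)"
    "foldl (sim_step (nfa_code A)) (pp (Suc r) (pp i' j')) zs
      = pp (Suc q) (pp (input_code i' (pi_in w)) (j' + length (pi_out w)))"
    using Cons.IH[OF r(2)] by blast
  have "sim_step (nfa_code A) (pp (Suc p) (pp i j)) (trans_code (p, c, r)) = pp (Suc r) (pp i' j')"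
    unfolding sim_step_trans[OF r(1)] i'_def j'_def by (simp split: sum.split)
  moreover have "input_code i' (pi_in w) = input_code i (pi_in (c # w))"
    "j' + length (pi_out w) = j + length (pi_out (c # w))"
    by (cases c; simp add: i'_def j'_def input_code_def)+
  ultimately show ?case using zs r(1)
    by (intro exI[of _ "trans_code (p, c, r) # zs"]) (simp del: trans_code.simps)
qed

lemma sim_fail: "foldl (sim_step a) 0 zs = 0"
proof (induction zs)
  case (Cons z zs)
  have "pp 0 0 = 0" by (simp add: pp_def prod_encode_def)
  then have "pf 0 = 0" by (metis pp_simps(1))
  then have "sim_step a 0 z = 0" by (simp add: sim_step_def)
  then show ?case using Cons by simp
qed simp

text \<open>A failed step yields 0, which is absorbing by \<open>sim_fail\<close>. A nonzero first
  component at the end thus certifies that every listed code was a transition leaving the current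
  state.\<close>

lemma sim_path:
  "pf (foldl (sim_step (nfa_code A)) (pp (Suc p) (pp i j)) zs) \<noteq> 0 \<Longrightarrow>
    \<exists>w q. path (trans A) p w q \<and> length w = length zs \<and>
      foldl (sim_step (nfa_code A)) (pp (Suc p) (pp i j)) zs
        = pp (Suc q) (pp (input_code i (pi_in w)) (j + length (pi_out w)))"
proof (induction zs arbitrary: p i j)
  case Nil
  show ?case by (intro exI[of _ "[]"] exI[of _ p]) (simp add: input_code_def)
next
  case (Cons z zs)
  let ?s = "sim_step (nfa_code A) (pp (Suc p) (pp i j)) z"
  have pf0: "pf 0 = 0"
  proof -
    have "pp 0 0 = 0" by (simp add: pp_def prod_encode_def)
    then show ?thesis by (metis pp_simps(1))
  qed
  have "?s \<noteq> 0"
  proof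
    assume "?s = 0"
    then show False using Cons.prems sim_fail pf0 by simp
  qed
  then have z: "z \<in> trans_code ` set (trans A)" "pf z = p"
    unfolding sim_step_def by (auto split: if_splits)
  then obtain p' c r where "z = trans_code (p', c, r)" "(p', c, r) \<in> set (trans A)" by auto
  with z(2) have r: "z = trans_code (p, c, r)" "(p, c, r) \<in> set (trans A)" by (simp_all add: trans_code_pp del: trans_code.simps)
  define i' where "i' = (case c of Inl a \<Rightarrow> Suc (pp (2 * a) i) | Inr b \<Rightarrow> i)"
  define j' where "j' = (case c of Inl a \<Rightarrow> j | Inr b \<Rightarrow> Suc j)"
  have s: "?s = pp (Suc r) (pp i' j')"
    unfolding r(1) sim_step_trans[OF r(2)] i'_def j'_def by (simp split: sum.split)
  have "pf (foldl (sim_step (nfa_code A)) (pp (Suc r) (pp i' j')) zs) \<noteq> 0" using Cons.prems s by simp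
  from Cons.IH[OF this] obtain w q where w: "path (trans A) r w q" "length w = length zs"
    "foldl (sim_step (nfa_code A)) (pp (Suc r) (pp i' j')) zs
        = pp (Suc q) (pp (input_code i' (pi_in w)) (j' + length (pi_out w)))" by blast
  moreover have "input_code i' (pi_in w) = input_code i (pi_in (c # w))"
    "j' + length (pi_out w) = j + length (pi_out (c # w))"
    by (cases c; simp add: i'_def j'_def input_code_def)+
  ultimately show ?case using s r(2)
    by (intro exI[of _ "c # w"] exI[of _ q]) (simp add: path_Cons_iff; blast)
qed

lemma pp_0: "pp 0 0 = 0"
  by (simp add: pp_def prod_encode_def)

lemma accepts_run:
  assumes "accepts (nfa_code A) x"
  shows "\<exists>p\<in>set (inits A). \<exists>q\<in>set (finals A). \<exists>w. path (trans A) p w q \<and> length w \<le> x \<and>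
    sim (nfa_code A) x = pp (Suc q) (pp (input_code 0 (pi_in w)) (length (pi_out w)))"
proof -
  have "pf (sim (nfa_code A) x) \<noteq> 0" using assms by (simp add: accepts_def)
  then obtain w q where w: "path (trans A) (pf x) w q" "length w = length (list_decode (ps x))"
    "sim (nfa_code A) x = pp (Suc q) (pp (input_code 0 (pi_in w)) (length (pi_out w)))"
    using sim_path[of A "pf x" 0 0 "list_decode (ps x)"] unfolding sim_def pp_0 by auto
  have "length w \<le> ps x" using w(2) length_le_list_encode[of "list_decode (ps x)"] by simp
  also have "\<dots> \<le> x" using le_prod_encode_2[of "ps x" "pf x"] by (simp flip: pp_def)
  finally have "length w \<le> x" .
  moreover have "pf x \<in> set (inits A)" "q \<in> set (finals A)" using assms w(3) by (simp_all add: accepts_def)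
  ultimately show ?thesis using w(1,3) by blast
qed

lemma trans_code_le: "t \<in> set (trans A) \<Longrightarrow> trans_code t \<le> nfa_code A"
proof -
  assume "t \<in> set (trans A)"
  then have "trans_code t \<le> list_encode (map trans_code (trans A))" by (intro member_le_list_encode) simp
  also have "\<dots> \<le> nfa_code A" unfolding nfa_code_def by (intro member_le_list_encode) simp
  finally show ?thesis .
qed

lemma inits_le: "p \<in> set (inits A) \<Longrightarrow> p \<le> nfa_code A"
proof -
  assume "p \<in> set (inits A)"
  then have "p \<le> list_encode (inits A)" by (rule member_le_list_encode)
  also have "\<dots> \<le> nfa_code A" unfolding nfa_code_def by (intro member_le_list_encode) simp
  finally show ?thesis .
qed

lemma run_accepts:
  assumes "p \<in> set (inits A)" "q \<in> set (finals A)" "path (trans A) p w q" "length w \<le> l"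
  shows "\<exists>x<code_bound (nfa_code A) l. accepts (nfa_code A) x \<and>
    sim (nfa_code A) x = pp (Suc q) (pp (input_code 0 (pi_in w)) (length (pi_out w)))"
proof -
  from path_sim[OF assms(3), of 0 0] obtain zs where zs: "length zs = length w" "set zs \<subseteq> trans_code ` set (trans A)"
    "foldl (sim_step (nfa_code A)) (pp (Suc p) 0) zs
      = pp (Suc q) (pp (input_code 0 (pi_in w)) (length (pi_out w)))" by (auto simp: pp_0)
  have "list_encode zs \<le> list_bound (nfa_code A) l"
    using zs(1,2) assms(4) by (intro list_encode_bound) (auto simp del: trans_code.simps intro: trans_code_le)
  then have "pp p (list_encode zs) < code_bound (nfa_code A) l"
    using pp_mono[OF inits_le[OF assms(1)]] unfolding code_bound_def by (simp add: less_Suc_eq_le)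
  moreover have "sim (nfa_code A) (pp p (list_encode zs)) = pp (Suc q) (pp (input_code 0 (pi_in w)) (length (pi_out w)))"
    using zs(3) by (simp add: sim_def)
  moreover from this have "accepts (nfa_code A) (pp p (list_encode zs))"
    using assms(1,2) by (simp add: accepts_def)
  ultimately show ?thesis by blast
qed

lemma length_pi: "length w = length (pi_in w) + length (pi_out w)"
  by (induction w rule: pi_in.induct) auto

text \<open>Pairing and list codes dominate their components, so the code itself bounds the
  states.\<close>

lemma bounded_nfa_code: "wf_input m k A \<Longrightarrow> bounded_nfa A (Suc (nfa_code A)) m k"
proof (unfold_locales)
  fix p c q assume t: "(p, c, q) \<in> set (trans A)"
  have "p \<le> trans_code (p, c, q)" by (simp add: le_prod_encode_1)
  moreover have "q \<le> trans_code (p, c, q)"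
    using le_prod_encode_2[of q "letter_code c"] le_prod_encode_2[of "prod_encode (letter_code c, q)" p] by simp
  ultimately show "p < Suc (nfa_code A) \<and> q < Suc (nfa_code A)" using trans_code_le[OF t] by simp
qed (auto simp: less_Suc_eq_le intro: inits_le)

theorem decider_correct:
  assumes "wf_input m k A"
  shows "decider k (nfa_code A) \<longleftrightarrow> has_recognizable_uniformization m k (rat_rel A)"
proof -
  let ?a = "nfa_code A"
  let ?N = "output_bound ?a"
  interpret bounded_nfa A "Suc ?a" m k by (rule bounded_nfa_code[OF assms])
  have "length (trans A) \<le> list_encode (map trans_code (trans A))"
    using length_le_list_encode[of "map trans_code (trans A)"] by simp
  also have "\<dots> \<le> ?a" unfolding nfa_code_def by (intro member_le_list_encode) simp
  finally have N: "cost_bound \<le> ?N" unfolding cost_bound_def output_bound_def by (intro mult_le_mono) simp_all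
  have L: "run_bound ?N = length_bound k ?a" unfolding run_bound_def length_bound_def ..
  \<comment> \<open>Overestimating \<open>cost_bound\<close> is harmless: boundedness by any
    constant gives a uniformization, which in turn forces boundedness by
    \<open>cost_bound\<close>.\<close>
  have unif: "has_recognizable_uniformization m k (rat_rel A) \<longleftrightarrow> bounded_outputs ?N (rat_rel A)"
    using uniformization_iff_cost_bound bounded_outputs_mono[OF _ N] bounded_uniformization by blast
  show ?thesis unfolding unif
  proof
    assume dec: "decider k ?a"
    show "bounded_outputs ?N (rat_rel A)"
    proof (rule bounded_outputs_short_runs)
      fix p w q
      assume w: "p \<in> set (inits A)" "q \<in> set (finals A)" "path (trans A) p w q" "length w < run_bound ?N"
      obtain x where x: "x < code_bound ?a (length_bound k ?a)" "accepts ?a x"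
        "sim ?a x = pp (Suc q) (pp (input_code 0 (pi_in w)) (length (pi_out w)))"
        using run_accepts[OF w(1,2,3), of "length_bound k ?a"] w(4) L by auto
      obtain y where y: "accepts ?a y" "pf (ps (sim ?a y)) = pf (ps (sim ?a x))" "ps (ps (sim ?a y)) \<le> ?N"
        using dec x(1,2) unfolding decider_def by blast
      obtain p' q' w' where w': "p' \<in> set (inits A)" "q' \<in> set (finals A)" "path (trans A) p' w' q'"
        "sim ?a y = pp (Suc q') (pp (input_code 0 (pi_in w')) (length (pi_out w')))"
        using accepts_run[OF y(1)] by blast
      have "pi_in w' = pi_in w" using y(2) w'(4) x(3) by (intro input_code_inj) simp
      moreover have "length (pi_out w') \<le> ?N" using y(3) w'(4) by simp
      moreover have "(pi_in w', pi_out w') \<in> rat_rel A" using w'(1-3) unfolding rat_rel_iff by blast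
      ultimately show "\<exists>v. (pi_in w, v) \<in> rat_rel A \<and> length v \<le> ?N" by auto
    qed
  next
    assume bd: "bounded_outputs ?N (rat_rel A)"
    show "decider k ?a" unfolding decider_def
    proof (intro allI impI)
      fix x assume x: "x < code_bound ?a (length_bound k ?a)" "accepts ?a x"
      obtain p q w where w: "p \<in> set (inits A)" "q \<in> set (finals A)" "path (trans A) p w q" "length w \<le> x"
        "sim ?a x = pp (Suc q) (pp (input_code 0 (pi_in w)) (length (pi_out w)))"
        using accepts_run[OF x(2)] by blast
      have "pi_in w \<in> Domain (rat_rel A)" using w(1-3) unfolding Domain_iff rat_rel_iff by blast
      then obtain v where v: "(pi_in w, v) \<in> rat_rel A" "length v \<le> ?N"
        using bd unfolding bounded_outputs_def by blast
      then obtain p' q' w' where w': "p' \<in> set (inits A)" "q' \<in> set (finals A)" "path (trans A) p' w' q'"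
        "pi_in w' = pi_in w" "pi_out w' = v" unfolding rat_rel_iff by blast
      have "length w' \<le> code_bound ?a (length_bound k ?a) + ?N"
        using length_pi[of w'] length_pi[of w] w'(4,5) v(2) w(4) x(1) by simp
      from run_accepts[OF w'(1-3) this] obtain y where
        "y < code_bound ?a (code_bound ?a (length_bound k ?a) + ?N)" "accepts ?a y"
        "sim ?a y = pp (Suc q') (pp (input_code 0 (pi_in w')) (length (pi_out w')))" by blast
      then show "\<exists>y<code_bound ?a (code_bound ?a (length_bound k ?a) + ?N). accepts ?a y \<and>
          pf (ps (sim ?a y)) = pf (ps (sim ?a x)) \<and> ps (ps (sim ?a y)) \<le> ?N"
        using w' w(5) v(2) by (intro exI[of _ y]) simp
    qed
  qed
qed

theorem mainTheorem2:
  fixes m k :: nat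
  shows "\<exists>f :: recf. \<forall>A :: (nat + nat) nfa. wf_input m k A \<longrightarrow>
           (\<exists>r. eval f [nfa_code A] r) \<and>
           (\<forall>r. eval f [nfa_code A] r \<longrightarrow>
              r = (if has_recognizable_uniformization m k (rat_rel A) then 1 else 0))"
proof -
  obtain f where f: "\<forall>xs. length xs = 1 \<longrightarrow> eval f xs (if decider k (xs ! 0) then 1 else 0)"
    using cp_decider[of k] unfolding cp_def cf_def cfn_def by (elim exE)
  have "eval f [nfa_code A] (if has_recognizable_uniformization m k (rat_rel A) then 1 else 0)"
    if "wf_input m k A" for A
    using f[rule_format, of "[nfa_code A]"] decider_correct[OF that] by simp
  then show ?thesis using eval_det by blast
qed

end
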